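(* Let $(\mathbb{C},p)$ be a natural model, let $(\mathbb{D},q)$ be a natural model admitting a unit type, and let $F:(\mathbb{C},p)\to(\mathbb{D},q)$ be a morphism of natural models. There is a unique unit type structure preserving morphism of natural models $F^\sharp:(\mathbb{C}_{\mathbb{1}},p_{\mathbb{1}})\to(\mathbb{D},q)$ such that $F^\sharp\circ I=F$.
   Context: $\mathsf{y}$ is the Yoneda embedding; elements $x\in P(\Gamma)$ of a presheaf are identified with maps $\mathsf{y}(\Gamma)\to P$, and $x[\sigma]=P(\sigma)(x)$. A natural model $(\mathbb{C},p)$ consists of a small category $\mathbb{C}$ with a distinguished terminal object $\diamond$, presheaves $\mathcal{U},\dot{\mathcal{U}}$ on $\mathbb{C}$, a natural transformation $p:\dot{\mathcal{U}}\to\mathcal{U}$ and, for each object $\Gamma$ and $A\in\mathcal{U}(\Gamma)$, a chosen object $\Gamma\cdot A$, morphism $\mathsf{p}_A:\Gamma\cdot A\to\Gamma$ and element $\mathsf{q}_A\in\dot{\mathcal{U}}(\Gamma\cdot A)$ such that the square with top $\mathsf{q}_A$, right $p$, left $\mathsf{y}(\mathsf{p}_A)$, bottom $A$ is a pullback. A morphism of natural models $F:(\mathbb{C},p)\to(\mathbb{D},q:\dot{\mathcal{V}}\to\mathcal{V})$ is a functor $F:\mathbb{C}\to\mathbb{D}$ strictly preserving distinguished terminal objects together with functions $A\mapsto FA:\mathcal{U}(\Gamma)\to\mathcal{V}(F\Gamma)$ and $a\mapsto Fa:\dot{\mathcal{U}}(\Gamma)\to\dot{\mathcal{V}}(F\Gamma)$,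 natural in $\Gamma$, with $q(Fa)=F(p(a))$ and strictly preserving the chosen data: $F(\Gamma\cdot A)=F\Gamma\cdot FA$, $F(\mathsf{p}_A)=\mathsf{p}_{FA}$, $F(\mathsf{q}_A)=\mathsf{q}_{FA}$. A natural model admitting a unit type is one equipped with $\widehat{\mathbb{1}}\in\mathcal{U}(\diamond)$ and $\widehat\star\in\dot{\mathcal{U}}(\diamond)$ such that the square with top $\widehat\star:\mathsf{y}(\diamond)\to\dot{\mathcal{U}}$, right $p$, left the identity of $\mathsf{y}(\diamond)$, bottom $\widehat{\mathbb{1}}$ is a pullback; a morphism preserves unit type structure if it sends $\widehat{\mathbb{1}}$ to $\widehat{\mathbb{1}}$ and $\widehat\star$ to $\widehat\star$. **The free natural model $(\mathbb{C}_{\mathbb{1}},p_{\mathbb{1}})$ admitting a unit type on $(\mathbb{C},p)$.** Objects of $\mathbb{C}_{\mathbb{1}}$ are lists $(\Gamma,k_0,A_1,k_1,\dots,A_n,k_n)$, $n\ge0$, with $\Gamma\in\mathrm{ob}(\mathbb{C})$, $k_i\in\mathbb{N}$ and $A_i\in\mathcal{U}(\Gamma\cdot A_1\cdots A_{i-1})$, where $(\Gamma,0,A_1,k_1,\dots,A_n,k_n)$ is identified with $(\Gamma\cdot A_1,k_1,\dots,A_n,k_n)$. A morphism $(\Delta,\ell_0,B_1,\dots,B_m,\ell_m)\to(\Gamma,k_0,A_1,\dots,A_n,k_n)$ is a morphism $\Delta\cdot B_1\cdots B_m\to\Gamma\cdot A_1\cdots A_n$ of $\mathbb{C}$, with composition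 and identities from $\mathbb{C}$. The terminal object is $(\diamond,0)$. For $\vec\Gamma=(\Gamma,k_0,A_1,\dots,A_n,k_n)$: $\mathcal{U}_{\mathbb{1}}(\vec\Gamma)=\{\bullet\}+\mathcal{U}(\Gamma\cdot A_1\cdots A_n)$, $\dot{\mathcal{U}}_{\mathbb{1}}(\vec\Gamma)=\{\bullet\}+\dot{\mathcal{U}}(\Gamma\cdot A_1\cdots A_n)$, with the evident actions, and $p_{\mathbb{1}}=\mathrm{id}+p$. Representability data: $\vec\Gamma\cdot\bullet=(\Gamma,k_0,A_1,\dots,A_n,k_n+1)$ with projection given by the identity of $\Gamma\cdot A_1\cdots A_n$ and variable $\bullet$; for $A\in\mathcal{U}(\Gamma\cdot A_1\cdots A_n)$, $\vec\Gamma\cdot A=(\Gamma,k_0,A_1,\dots,A_n,k_n,A,0)$ with projection $\mathsf{p}_A$ and variable $\mathsf{q}_A$. The unit type structure is $\widehat{\mathbb{1}}=\bullet\in\mathcal{U}_{\mathbb{1}}(\diamond,0)$, $\widehat\star=\bullet\in\dot{\mathcal{U}}_{\mathbb{1}}(\diamond,0)$. The inclusion $I:(\mathbb{C},p)\to(\mathbb{C}_{\mathbb{1}},p_{\mathbb{1}})$ is the morphism of natural models with $I\Gamma=(\Gamma,0)$, $I\sigma=\sigma$, $IA=A$, $Ia=a$. *)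

theory Defs
  imports "HOL-Library.FuncSet"
begin

text \<open>
  Conventions. Hom-sets, presheaves and natural transformations are families indexed by objects;
  hom-sets need not be disjoint, so composition and restriction maps carry their end points as
  arguments. All such families are empty outside the objects of the category.
\<close>

record ('o, 'm) cat_data =
  obj :: "'o set"
  hom :: "'o \<Rightarrow> 'o \<Rightarrow> 'm set"
  idn :: "'o \<Rightarrow> 'm"
  \<comment> \<open>\<open>cmp C X Y Z g f\<close> is the composite of \<open>f : X \<rightarrow> Y\<close> followed by \<open>g : Y \<rightarrow> Z\<close>\<close>
  cmp :: "'o \<Rightarrow> 'o \<Rightarrow> 'o \<Rightarrow> 'm \<Rightarrow> 'm \<Rightarrow> 'm"

record ('o, 'm, 'x) psh_data =
  elts :: "'o \<Rightarrow> 'x set"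
  \<comment> \<open>\<open>act P Y X f x\<close> is \<open>x[f]\<close> for \<open>f : Y \<rightarrow> X\<close> and \<open>x \<in> P(X)\<close>\<close>
  act :: "'o \<Rightarrow> 'o \<Rightarrow> 'm \<Rightarrow> 'x \<Rightarrow> 'x"

locale category =
  fixes C :: "('o, 'm, 'z) cat_data_scheme"
  assumes hom_obj: "f \<in> hom C X Y \<Longrightarrow> X \<in> obj C \<and> Y \<in> obj C"
    and idn_hom: "X \<in> obj C \<Longrightarrow> idn C X \<in> hom C X X"
    and cmp_hom: "f \<in> hom C X Y \<Longrightarrow> g \<in> hom C Y Z \<Longrightarrow> cmp C X Y Z g f \<in> hom C X Z"
    and cmp_idn_right: "f \<in> hom C X Y \<Longrightarrow> cmp C X X Y f (idn C X) = f"
    and cmp_idn_left: "f \<in> hom C X Y \<Longrightarrow> cmp C X Y Y (idn C Y) f = f"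
    and cmp_assoc: "f \<in> hom C W X \<Longrightarrow> g \<in> hom C X Y \<Longrightarrow> h \<in> hom C Y Z \<Longrightarrow>
      cmp C W X Z (cmp C X Y Z h g) f = cmp C W Y Z h (cmp C W X Y g f)"

definition terminal :: "('o, 'm, 'z) cat_data_scheme \<Rightarrow> 'o \<Rightarrow> bool" where
  "terminal C T \<longleftrightarrow> T \<in> obj C \<and> (\<forall>X\<in>obj C. \<exists>!f. f \<in> hom C X T)"

locale presheaf = category C
  for C :: "('o, 'm, 'z) cat_data_scheme" and P :: "('o, 'm, 'x) psh_data" +
  assumes elts_obj: "x \<in> elts P X \<Longrightarrow> X \<in> obj C"
    and act_elts: "f \<in> hom C Y X \<Longrightarrow> x \<in> elts P X \<Longrightarrow> act P Y X f x \<in> elts P Y"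
    and act_idn: "x \<in> elts P X \<Longrightarrow> act P X X (idn C X) x = x"
    and act_cmp: "g \<in> hom C Z Y \<Longrightarrow> f \<in> hom C Y X \<Longrightarrow> x \<in> elts P X \<Longrightarrow>
      act P Z X (cmp C Z Y X f g) x = act P Z Y g (act P Y X f x)"

locale nat_trans = dom: presheaf C P + cod: presheaf C Q
  for C :: "('o, 'm, 'z) cat_data_scheme" and P :: "('o, 'm, 'x) psh_data"
    and Q :: "('o, 'm, 'y) psh_data" +
  fixes t :: "'o \<Rightarrow> 'x \<Rightarrow> 'y"
  assumes component: "x \<in> elts P X \<Longrightarrow> t X x \<in> elts Q X"
    and natural: "f \<in> hom C Y X \<Longrightarrow> x \<in> elts P X \<Longrightarrow>
      t Y (act P Y X f x) = act Q Y X f (t X x)"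

definition yo :: "('o, 'm, 'z) cat_data_scheme \<Rightarrow> 'o \<Rightarrow> ('o, 'm, 'm) psh_data" where
  "yo C X = \<lparr>elts = (\<lambda>Y. hom C Y X), act = (\<lambda>Z Y g f. cmp C Z Y X f g)\<rparr>"

text \<open>The map \<open>yo C X \<rightarrow> yo C Y\<close> induced by \<open>f : X \<rightarrow> Y\<close>, and the map \<open>yo C X \<rightarrow> P\<close>
  corresponding to \<open>x \<in> P(X)\<close>.\<close>

definition yo_map :: "('o, 'm, 'z) cat_data_scheme \<Rightarrow> 'o \<Rightarrow> 'o \<Rightarrow> 'm \<Rightarrow> 'o \<Rightarrow> 'm \<Rightarrow> 'm" where
  "yo_map C X Y f = (\<lambda>Z g. cmp C Z X Y f g)"

definition elt_map :: "('o, 'm, 'x) psh_data \<Rightarrow> 'o \<Rightarrow> 'x \<Rightarrow> 'o \<Rightarrow> 'm \<Rightarrow> 'x" where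
  "elt_map P X x = (\<lambda>Y f. act P Y X f x)"

text \<open>A square \<open>P \<rightarrow> Q\<close> (top), \<open>P \<rightarrow> R\<close> (left), \<open>Q \<rightarrow> S\<close> (right), \<open>R \<rightarrow> S\<close> (bottom)
  is a pullback if the comparison map from \<open>P\<close> to the (componentwise) fibre product is invertible.
  The universal property among presheaves is derived below.\<close>

definition pullback_square ::
    "('o, 'm, 'z) cat_data_scheme \<Rightarrow> ('o, 'm, 'p) psh_data \<Rightarrow> ('o, 'm, 'q) psh_data \<Rightarrow>
     ('o, 'm, 'r) psh_data \<Rightarrow> ('o, 'm, 's) psh_data \<Rightarrow>
     ('o \<Rightarrow> 'p \<Rightarrow> 'q) \<Rightarrow> ('o \<Rightarrow> 'p \<Rightarrow> 'r) \<Rightarrow> ('o \<Rightarrow> 'q \<Rightarrow> 's) \<Rightarrow> ('o \<Rightarrow> 'r \<Rightarrow> 's) \<Rightarrow> bool" where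
  "pullback_square C P Q R S tp lt rt bt \<longleftrightarrow>
     nat_trans C P Q tp \<and> nat_trans C P R lt \<and> nat_trans C Q S rt \<and> nat_trans C R S bt \<and>
     (\<forall>X\<in>obj C. bij_betw (\<lambda>x. (lt X x, tp X x)) (elts P X)
        {(r, q). r \<in> elts R X \<and> q \<in> elts Q X \<and> bt X r = rt X q})"

definition cone ::
    "('o, 'm, 'z) cat_data_scheme \<Rightarrow> ('o, 'm, 't) psh_data \<Rightarrow> ('o, 'm, 'q) psh_data \<Rightarrow>
     ('o, 'm, 'r) psh_data \<Rightarrow>
     ('o \<Rightarrow> 'q \<Rightarrow> 's) \<Rightarrow> ('o \<Rightarrow> 'r \<Rightarrow> 's) \<Rightarrow> ('o \<Rightarrow> 't \<Rightarrow> 'q) \<Rightarrow> ('o \<Rightarrow> 't \<Rightarrow> 'r) \<Rightarrow> bool" where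
  "cone C T Q R rt bt g f \<longleftrightarrow> nat_trans C T Q g \<and> nat_trans C T R f \<and>
     (\<forall>X. \<forall>t\<in>elts T X. rt X (g X t) = bt X (f X t))"

definition factors ::
    "('o, 'm, 'z) cat_data_scheme \<Rightarrow> ('o, 'm, 't) psh_data \<Rightarrow> ('o, 'm, 'p) psh_data \<Rightarrow>
     ('o \<Rightarrow> 'p \<Rightarrow> 'q) \<Rightarrow> ('o \<Rightarrow> 'p \<Rightarrow> 'r) \<Rightarrow> ('o \<Rightarrow> 't \<Rightarrow> 'q) \<Rightarrow> ('o \<Rightarrow> 't \<Rightarrow> 'r) \<Rightarrow>
     ('o \<Rightarrow> 't \<Rightarrow> 'p) \<Rightarrow> bool" where
  "factors C T P tp lt g f u \<longleftrightarrow> nat_trans C T P u \<and>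
     (\<forall>X. \<forall>t\<in>elts T X. tp X (u X t) = g X t \<and> lt X (u X t) = f X t)"

lemma pullback_square_commutes:
  assumes "pullback_square C P Q R S tp lt rt bt" and x: "x \<in> elts P X"
  shows "rt X (tp X x) = bt X (lt X x)"
proof -
  interpret tpi: nat_trans C P Q tp using assms by (simp add: pullback_square_def)
  have "X \<in> obj C" using x tpi.dom.elts_obj by blast
  then have "(\<lambda>x. (lt X x, tp X x)) ` elts P X =
      {(r, q). r \<in> elts R X \<and> q \<in> elts Q X \<and> bt X r = rt X q}"
    using assms by (auto simp: pullback_square_def bij_betw_def)
  then have "(lt X x, tp X x) \<in> {(r, q). r \<in> elts R X \<and> q \<in> elts Q X \<and> bt X r = rt X q}"
    using x by (metis (lifting) image_eqI)
  then show ?thesis by simp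
qed

lemma pullback_square_universal:
  fixes T :: "('o, 'm, 't) psh_data" and P :: "('o, 'm, 'p) psh_data"
  assumes pb: "pullback_square C P Q R S tp lt rt bt"
    and cn: "cone C T Q R rt bt g f"
  obtains u where "factors C T P tp lt g f u"
    and "\<And>v X t. factors C T P tp lt g f v \<Longrightarrow> t \<in> elts T X \<Longrightarrow> v X t = u X t"
proof -
  interpret tpi: nat_trans C P Q tp using pb by (simp add: pullback_square_def)
  interpret lf: nat_trans C P R lt using pb by (simp add: pullback_square_def)
  interpret g: nat_trans C T Q g using cn by (simp add: cone_def)
  interpret f: nat_trans C T R f using cn by (simp add: cone_def)
  let ?m = "\<lambda>X x. (lt X x, tp X x)"
  have bij: "bij_betw (?m X) (elts P X)
      {(r, q). r \<in> elts R X \<and> q \<in> elts Q X \<and> bt X r = rt X q}" if "X \<in> obj C" for X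
    using pb that by (simp add: pullback_square_def)
  have inj: "x = y" if "x \<in> elts P X" "y \<in> elts P X" "lt X x = lt X y" "tp X x = tp X y"
    for x y X
    using bij[OF tpi.dom.elts_obj[OF that(1)]] that by (auto simp: bij_betw_def inj_on_def)
  have ex: "\<exists>x\<in>elts P X. lt X x = f X t \<and> tp X x = g X t" if t: "t \<in> elts T X" for X t
  proof -
    have "(f X t, g X t) \<in> {(r, q). r \<in> elts R X \<and> q \<in> elts Q X \<and> bt X r = rt X q}"
      using t cn f.component g.component by (auto simp: cone_def)
    then have "(f X t, g X t) \<in> ?m X ` elts P X"
      using bij[OF g.dom.elts_obj[OF t]] by (simp add: bij_betw_def)
    then show ?thesis by auto
  qed
  define u where "u X t = (SOME x. x \<in> elts P X \<and> lt X x = f X t \<and> tp X x = g X t)" for X t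
  have u: "u X t \<in> elts P X \<and> lt X (u X t) = f X t \<and> tp X (u X t) = g X t"
    if "t \<in> elts T X" for X t
    unfolding u_def by (rule someI_ex) (use ex[OF that] in blast)
  have "nat_trans C T P u"
  proof
    fix t X assume "t \<in> elts T X" then show "u X t \<in> elts P X" using u by blast
  next
    fix h Y X t assume h: "h \<in> hom C Y X" and t: "t \<in> elts T X"
    have ht: "act T Y X h t \<in> elts T Y" using h t by (rule g.dom.act_elts)
    show "u Y (act T Y X h t) = act P Y X h (u X t)"
      using h t u[OF t] u[OF ht]
      by (intro inj[of _ Y])
        (auto simp: tpi.dom.act_elts f.natural g.natural tpi.natural lf.natural)
  qed
  then have "factors C T P tp lt g f u" using u by (auto simp: factors_def)
  moreover have "v X t = u X t" if "factors C T P tp lt g f v" "t \<in> elts T X" for v X t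
    using that u[OF that(2)] by (intro inj[of _ X]) (auto simp: factors_def nat_trans.component)
  ultimately show ?thesis using that by blast
qed

lemma pullback_squareI:
  fixes P :: "('o, 'm, 'p) psh_data" and Q :: "('o, 'm, 'q) psh_data"
    and R :: "('o, 'm, 'r) psh_data" and C :: "('o, 'm, 'z) cat_data_scheme"
  assumes nt: "nat_trans C Q S rt" "nat_trans C R S bt"
    and cn: "cone C P Q R rt bt tp lt"
    and ex: "\<And>(T :: ('o, 'm, 'r \<times> 'q) psh_data) g f. cone C T Q R rt bt g f \<Longrightarrow>
      \<exists>u. factors C T P tp lt g f u"
    and unique: "\<And>u v X x. factors C P P tp lt tp lt u \<Longrightarrow> factors C P P tp lt tp lt v \<Longrightarrow>
      x \<in> elts P X \<Longrightarrow> u X x = v X x"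
  shows "pullback_square C P Q R S tp lt rt bt"
proof -
  interpret tpi: nat_trans C P Q tp using cn by (simp add: cone_def)
  interpret lf: nat_trans C P R lt using cn by (simp add: cone_def)
  interpret r: nat_trans C Q S rt by (rule nt)
  interpret b: nat_trans C R S bt by (rule nt)
  define T where "T = \<lparr>elts = (\<lambda>X. {(r, q). r \<in> elts R X \<and> q \<in> elts Q X \<and> bt X r = rt X q}),
    act = (\<lambda>Y X f (r, q). (act R Y X f r, act Q Y X f q))\<rparr>"
  have T: "presheaf C T"
    by unfold_locales
      (auto simp: T_def lf.cod.elts_obj lf.cod.act_elts tpi.cod.act_elts
        b.natural r.natural lf.cod.act_idn tpi.cod.act_idn lf.cod.act_cmp tpi.cod.act_cmp)
  have "cone C T Q R rt bt (\<lambda>_. snd) (\<lambda>_. fst)"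
    using T tpi.cod.presheaf_axioms lf.cod.presheaf_axioms
    by (auto simp: cone_def nat_trans_def nat_trans_axioms_def T_def)
  from ex[OF this] obtain u where u: "factors C T P tp lt (\<lambda>_. snd) (\<lambda>_. fst) u" by blast
  let ?m = "\<lambda>X x. (lt X x, tp X x)"
  have m: "?m X x \<in> elts T X" if "x \<in> elts P X" for X x
    using that cn lf.component tpi.component by (auto simp: cone_def T_def)
  interpret u: nat_trans C T P u using u by (simp add: factors_def)
  have mu: "?m X (u X t) = t" if "t \<in> elts T X" for X t
    using u that by (auto simp: factors_def prod_eq_iff)
  have mnat: "?m Y (act P Y X f x) = act T Y X f (?m X x)"
    if "f \<in> hom C Y X" "x \<in> elts P X" for f X Y x
    using that by (simp add: T_def lf.natural tpi.natural)
  have "nat_trans C P P (\<lambda>X x. u X (?m X x))"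
  proof
    show "u X (?m X x) \<in> elts P X" if "x \<in> elts P X" for x X
      using m[OF that] by (rule u.component)
    show "u Y (?m Y (act P Y X f x)) = act P Y X f (u X (?m X x))"
      if "f \<in> hom C Y X" "x \<in> elts P X" for f X Y x
      unfolding mnat[OF that] by (rule u.natural[OF that(1) m[OF that(2)]])
  qed
  then have "factors C P P tp lt tp lt (\<lambda>X x. u X (?m X x))"
    using mu[OF m] by (auto simp: factors_def)
  moreover have "factors C P P tp lt tp lt (\<lambda>X x. x)"
    using tpi.dom.presheaf_axioms by (auto simp: factors_def nat_trans_def nat_trans_axioms_def)
  ultimately have um: "u X (?m X x) = x" if "x \<in> elts P X" for X x
    using unique that by blast
  have "bij_betw (?m X) (elts P X) (elts T X)" for X
    by (rule bij_betw_byWitness[where f' = "u X"]) (use um mu m u.component in auto)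
  then show ?thesis
    using nt tpi.nat_trans_axioms lf.nat_trans_axioms by (simp add: pullback_square_def T_def)
qed

record ('o, 'm, 'u, 'e) model_data =
  base :: "('o, 'm) cat_data"
  trm :: "'o"
  Ty :: "('o, 'm, 'u) psh_data"
  Tm :: "('o, 'm, 'e) psh_data"
  ty_of :: "'o \<Rightarrow> 'e \<Rightarrow> 'u"
  ext :: "'o \<Rightarrow> 'u \<Rightarrow> 'o"
  prj :: "'o \<Rightarrow> 'u \<Rightarrow> 'm"
  var :: "'o \<Rightarrow> 'u \<Rightarrow> 'e"

record ('o, 'm, 'u, 'e) unit_model_data = "('o, 'm, 'u, 'e) model_data" +
  unit_ty :: "'u"
  unit_tm :: "'e"

locale natural_model = nat_trans "base M" "Tm M" "Ty M" "ty_of M"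
  for M :: "('o, 'm, 'u, 'e, 'z) model_data_scheme" +
  assumes trm_terminal: "terminal (base M) (trm M)"
    and ext_obj: "A \<in> elts (Ty M) \<Gamma> \<Longrightarrow> ext M \<Gamma> A \<in> obj (base M)"
    and prj_hom: "A \<in> elts (Ty M) \<Gamma> \<Longrightarrow> prj M \<Gamma> A \<in> hom (base M) (ext M \<Gamma> A) \<Gamma>"
    and var_elts: "A \<in> elts (Ty M) \<Gamma> \<Longrightarrow> var M \<Gamma> A \<in> elts (Tm M) (ext M \<Gamma> A)"
    and ext_pullback: "A \<in> elts (Ty M) \<Gamma> \<Longrightarrow>
      pullback_square (base M)
        (yo (base M) (ext M \<Gamma> A)) (Tm M) (yo (base M) \<Gamma>) (Ty M)
        (elt_map (Tm M) (ext M \<Gamma> A) (var M \<Gamma> A))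
        (yo_map (base M) (ext M \<Gamma> A) \<Gamma> (prj M \<Gamma> A))
        (ty_of M)
        (elt_map (Ty M) \<Gamma> A)"

locale unit_natural_model = natural_model M
  for M :: "('o, 'm, 'u, 'e, 'z) unit_model_data_scheme" +
  assumes unit_ty_elts: "unit_ty M \<in> elts (Ty M) (trm M)"
    and unit_tm_elts: "unit_tm M \<in> elts (Tm M) (trm M)"
    and unit_pullback:
      "pullback_square (base M)
        (yo (base M) (trm M)) (Tm M) (yo (base M) (trm M)) (Ty M)
        (elt_map (Tm M) (trm M) (unit_tm M))
        (\<lambda>_. id)
        (ty_of M)
        (elt_map (Ty M) (trm M) (unit_ty M))"

record ('o, 'm, 'u, 'e, 'o2, 'm2, 'v, 'f) map_data =
  on_obj :: "'o \<Rightarrow> 'o2"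
  on_hom :: "'o \<Rightarrow> 'o \<Rightarrow> 'm \<Rightarrow> 'm2"
  on_ty :: "'o \<Rightarrow> 'u \<Rightarrow> 'v"
  on_tm :: "'o \<Rightarrow> 'e \<Rightarrow> 'f"

text \<open>The maps are required to be \<open>undefined\<close> outside their domains, so that equality of
  morphisms is equality of records.\<close>

locale model_morphism = dom: natural_model M + cod: natural_model N
  for M :: "('o, 'm, 'u, 'e, 'z) model_data_scheme"
    and N :: "('o2, 'm2, 'v, 'f, 'z2) model_data_scheme" +
  fixes F :: "('o, 'm, 'u, 'e, 'o2, 'm2, 'v, 'f) map_data"
  assumes on_obj: "on_obj F \<in> obj (base M) \<rightarrow>\<^sub>E obj (base N)"
    and on_hom: "on_hom F X Y \<in> hom (base M) X Y \<rightarrow>\<^sub>E hom (base N) (on_obj F X) (on_obj F Y)"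
    and on_idn: "X \<in> obj (base M) \<Longrightarrow>
      on_hom F X X (idn (base M) X) = idn (base N) (on_obj F X)"
    and on_cmp: "f \<in> hom (base M) X Y \<Longrightarrow> g \<in> hom (base M) Y Z \<Longrightarrow>
      on_hom F X Z (cmp (base M) X Y Z g f) =
        cmp (base N) (on_obj F X) (on_obj F Y) (on_obj F Z) (on_hom F Y Z g) (on_hom F X Y f)"
    and on_trm: "on_obj F (trm M) = trm N"
    and on_ty: "on_ty F \<Gamma> \<in> elts (Ty M) \<Gamma> \<rightarrow>\<^sub>E elts (Ty N) (on_obj F \<Gamma>)"
    and on_tm: "on_tm F \<Gamma> \<in> elts (Tm M) \<Gamma> \<rightarrow>\<^sub>E elts (Tm N) (on_obj F \<Gamma>)"
    and on_ty_natural: "\<sigma> \<in> hom (base M) \<Delta> \<Gamma> \<Longrightarrow> A \<in> elts (Ty M) \<Gamma> \<Longrightarrow>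
      on_ty F \<Delta> (act (Ty M) \<Delta> \<Gamma> \<sigma> A) =
        act (Ty N) (on_obj F \<Delta>) (on_obj F \<Gamma>) (on_hom F \<Delta> \<Gamma> \<sigma>) (on_ty F \<Gamma> A)"
    and on_tm_natural: "\<sigma> \<in> hom (base M) \<Delta> \<Gamma> \<Longrightarrow> a \<in> elts (Tm M) \<Gamma> \<Longrightarrow>
      on_tm F \<Delta> (act (Tm M) \<Delta> \<Gamma> \<sigma> a) =
        act (Tm N) (on_obj F \<Delta>) (on_obj F \<Gamma>) (on_hom F \<Delta> \<Gamma> \<sigma>) (on_tm F \<Gamma> a)"
    and on_ty_of: "a \<in> elts (Tm M) \<Gamma> \<Longrightarrow>
      ty_of N (on_obj F \<Gamma>) (on_tm F \<Gamma> a) = on_ty F \<Gamma> (ty_of M \<Gamma> a)"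
    and on_ext: "A \<in> elts (Ty M) \<Gamma> \<Longrightarrow>
      on_obj F (ext M \<Gamma> A) = ext N (on_obj F \<Gamma>) (on_ty F \<Gamma> A)"
    and on_prj: "A \<in> elts (Ty M) \<Gamma> \<Longrightarrow>
      on_hom F (ext M \<Gamma> A) \<Gamma> (prj M \<Gamma> A) = prj N (on_obj F \<Gamma>) (on_ty F \<Gamma> A)"
    and on_var: "A \<in> elts (Ty M) \<Gamma> \<Longrightarrow>
      on_tm F (ext M \<Gamma> A) (var M \<Gamma> A) = var N (on_obj F \<Gamma>) (on_ty F \<Gamma> A)"

locale unit_model_morphism =
  model_morphism M N F + dom: unit_natural_model M + cod: unit_natural_model N
  for M :: "('o, 'm, 'u, 'e, 'z) unit_model_data_scheme"
    and N :: "('o2, 'm2, 'v, 'f, 'z2) unit_model_data_scheme"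
    and F :: "('o, 'm, 'u, 'e, 'o2, 'm2, 'v, 'f) map_data" +
  assumes on_unit_ty: "on_ty F (trm M) (unit_ty M) = unit_ty N"
    and on_unit_tm: "on_tm F (trm M) (unit_tm M) = unit_tm N"

definition compose_map ::
    "('o, 'm, 'u, 'e, 'z) model_data_scheme \<Rightarrow>
     ('o2, 'm2, 'v, 'f, 'o3, 'm3, 'w, 'g) map_data \<Rightarrow>
     ('o, 'm, 'u, 'e, 'o2, 'm2, 'v, 'f) map_data \<Rightarrow>
     ('o, 'm, 'u, 'e, 'o3, 'm3, 'w, 'g) map_data" where
  "compose_map M G F =
    \<lparr>on_obj = (\<lambda>X\<in>obj (base M). on_obj G (on_obj F X)),
     on_hom = (\<lambda>X Y. \<lambda>f\<in>hom (base M) X Y. on_hom G (on_obj F X) (on_obj F Y) (on_hom F X Y f)),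
     on_ty = (\<lambda>\<Gamma>. \<lambda>A\<in>elts (Ty M) \<Gamma>. on_ty G (on_obj F \<Gamma>) (on_ty F \<Gamma> A)),
     on_tm = (\<lambda>\<Gamma>. \<lambda>a\<in>elts (Tm M) \<Gamma>. on_tm G (on_obj F \<Gamma>) (on_tm F \<Gamma> a))\<rparr>"

text \<open>The list \<open>(\<Gamma>, k\<^sub>0, A\<^sub>1, k\<^sub>1, \<dots>, A\<^sub>n, k\<^sub>n)\<close> is encoded as
  \<open>(\<Gamma>, k\<^sub>0, [(A\<^sub>1, k\<^sub>1), \<dots>, (A\<^sub>n, k\<^sub>n)])\<close>.\<close>

type_synonym ('o, 'u) unit_ctx = "'o \<times> nat \<times> ('u \<times> nat) list"

fun valid_tel :: "('o, 'm, 'u, 'e, 'z) model_data_scheme \<Rightarrow> 'o \<Rightarrow> ('u \<times> nat) list \<Rightarrow> bool" where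
  "valid_tel M \<Gamma> [] \<longleftrightarrow> \<Gamma> \<in> obj (base M)"
| "valid_tel M \<Gamma> ((A, k) # As) \<longleftrightarrow> A \<in> elts (Ty M) \<Gamma> \<and> valid_tel M (ext M \<Gamma> A) As"

fun ext_tel :: "('o, 'm, 'u, 'e, 'z) model_data_scheme \<Rightarrow> 'o \<Rightarrow> ('u \<times> nat) list \<Rightarrow> 'o" where
  "ext_tel M \<Gamma> [] = \<Gamma>"
| "ext_tel M \<Gamma> ((A, k) # As) = ext_tel M (ext M \<Gamma> A) As"

definition unit_ctxs :: "('o, 'm, 'u, 'e, 'z) model_data_scheme \<Rightarrow> ('o, 'u) unit_ctx set" where
  "unit_ctxs M = {(\<Gamma>, k, As). valid_tel M \<Gamma> As}"

inductive absorb ::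
    "('o, 'm, 'u, 'e, 'z) model_data_scheme \<Rightarrow> ('o, 'u) unit_ctx \<Rightarrow> ('o, 'u) unit_ctx \<Rightarrow> bool"
  for M where
  "valid_tel M \<Gamma> ((A, k) # As) \<Longrightarrow> absorb M (\<Gamma>, 0, (A, k) # As) (ext M \<Gamma> A, k, As)"

definition ctx_rel ::
    "('o, 'm, 'u, 'e, 'z) model_data_scheme \<Rightarrow> ('o, 'u) unit_ctx rel" where
  "ctx_rel M = {(x, y). x \<in> unit_ctxs M \<and> y \<in> unit_ctxs M \<and> equivclp (absorb M) x y}"

definition ctx_class ::
    "('o, 'm, 'u, 'e, 'z) model_data_scheme \<Rightarrow> ('o, 'u) unit_ctx \<Rightarrow> ('o, 'u) unit_ctx set" where
  "ctx_class M x = ctx_rel M `` {x}"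

text \<open>The operations below are defined on equivalence classes via their representatives.
  \<open>flat M X\<close> is the object \<open>\<Gamma>\<cdot>A\<^sub>1\<cdots>A\<^sub>n\<close> of \<open>M\<close>, which is the same for all
  representatives.\<close>

definition flat ::
    "('o, 'm, 'u, 'e, 'z) model_data_scheme \<Rightarrow> ('o, 'u) unit_ctx set \<Rightarrow> 'o" where
  "flat M X = the_elem ((\<lambda>(\<Gamma>, k, As). ext_tel M \<Gamma> As) ` X)"

fun add_unit :: "('o, 'u) unit_ctx \<Rightarrow> ('o, 'u) unit_ctx" where
  "add_unit (\<Gamma>, k, As) =
     (if As = [] then (\<Gamma>, k + 1, [])
      else (\<Gamma>, k, butlast As @ [(fst (last As), snd (last As) + 1)]))"

fun add_ty :: "'u \<Rightarrow> ('o, 'u) unit_ctx \<Rightarrow> ('o, 'u) unit_ctx" where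
  "add_ty A (\<Gamma>, k, As) = (\<Gamma>, k, As @ [(A, 0)])"

definition free_cat ::
    "('o, 'm, 'u, 'e, 'z) model_data_scheme \<Rightarrow> (('o, 'u) unit_ctx set, 'm) cat_data" where
  "free_cat M =
    \<lparr>obj = unit_ctxs M // ctx_rel M,
     hom = (\<lambda>X Y. if X \<in> unit_ctxs M // ctx_rel M \<and> Y \<in> unit_ctxs M // ctx_rel M
                   then hom (base M) (flat M X) (flat M Y) else {}),
     idn = (\<lambda>X. idn (base M) (flat M X)),
     cmp = (\<lambda>X Y Z. cmp (base M) (flat M X) (flat M Y) (flat M Z))\<rparr>"

text \<open>\<open>{\<bullet>} + P(\<Gamma>\<cdot>A\<^sub>1\<cdots>A\<^sub>n)\<close>, with \<open>\<bullet>\<close> encoded as \<open>None\<close>.\<close>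

definition free_psh ::
    "('o, 'm, 'u, 'e, 'z) model_data_scheme \<Rightarrow> ('o, 'm, 'x) psh_data \<Rightarrow>
     (('o, 'u) unit_ctx set, 'm, 'x option) psh_data" where
  "free_psh M P =
    \<lparr>elts = (\<lambda>X. if X \<in> obj (free_cat M) then insert None (Some ` elts P (flat M X)) else {}),
     act = (\<lambda>Y X \<sigma>. map_option (act P (flat M Y) (flat M X) \<sigma>))\<rparr>"

definition free_unit_model ::
    "('o, 'm, 'u, 'e, 'z) model_data_scheme \<Rightarrow>
     (('o, 'u) unit_ctx set, 'm, 'u option, 'e option) unit_model_data" where
  "free_unit_model M =
    \<lparr>base = free_cat M,
     trm = ctx_class M (trm M, 0, []),
     Ty = free_psh M (Ty M),
     Tm = free_psh M (Tm M),
     ty_of = (\<lambda>X. map_option (ty_of M (flat M X))),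
     ext = (\<lambda>X A. case A of
         None \<Rightarrow> (\<Union>x\<in>X. ctx_class M (add_unit x))
       | Some B \<Rightarrow> (\<Union>x\<in>X. ctx_class M (add_ty B x))),
     prj = (\<lambda>X A. case A of
         None \<Rightarrow> idn (base M) (flat M X)
       | Some B \<Rightarrow> prj M (flat M X) B),
     var = (\<lambda>X A. map_option (var M (flat M X)) A),
     unit_ty = None,
     unit_tm = None\<rparr>"

definition free_incl ::
    "('o, 'm, 'u, 'e, 'z) model_data_scheme \<Rightarrow>
     ('o, 'm, 'u, 'e, ('o, 'u) unit_ctx set, 'm, 'u option, 'e option) map_data" where
  "free_incl M =
    \<lparr>on_obj = (\<lambda>\<Gamma>\<in>obj (base M). ctx_class M (\<Gamma>, 0, [])),
     on_hom = (\<lambda>\<Delta> \<Gamma>. \<lambda>\<sigma>\<in>hom (base M) \<Delta> \<Gamma>. \<sigma>),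
     on_ty = (\<lambda>\<Gamma>. \<lambda>A\<in>elts (Ty M) \<Gamma>. Some A),
     on_tm = (\<lambda>\<Gamma>. \<lambda>a\<in>elts (Tm M) \<Gamma>. Some a)\<rparr>"

end

(* In the free model the identity of flat(X) is a morphism from X to the inclusion of flat(X), and
   it is an isomorphism. So an extension G of F is determined on morphisms, types and terms by its
   objects G(X) together with isomorphisms G(X) -> F(flat X); types and terms are transported along
   them. Preservation of the chosen context extensions forces a recursion for these pairs:
   extension by the unit type composes the isomorphism with the (invertible) projection of the unit
   type of D, and extension by A replaces it by the induced map between the two extensions.
   Conversely the recursion, run on lists, is invariant under the identification of contexts and
   yields an extension of F. *)
theory Submission
  imports Defs
begin

text \<open>Strictness is the obstacle. In the free model, extending X by the unit type keeps the
  underlying object, whereas in D the chosen extension by the unit type is in general only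
  isomorphic to the object extended. A strict G has to follow the choices of D, so G(X) cannot
  simply be F(flat X). Invertibility is what makes the transport of morphisms possible: f from X to
  Y may be any map between the underlying objects, and conjugation turns it into a map from G(X) to
  G(Y). The identification of lists does no harm because it only happens when the leading counter is
  0: at that point the isomorphism is still an identity, F preserves extensions on the nose, and the
  lift of an identity is an identity. The value of G on the bullet is prescribed only over the
  terminal object; naturality forces it everywhere else.\<close>

section \<open>Isomorphisms in a category\<close>

definition inverse_pair :: "('o, 'm, 'z) cat_data_scheme \<Rightarrow> 'o \<Rightarrow> 'o \<Rightarrow> 'm \<Rightarrow> 'm \<Rightarrow> bool" where
  "inverse_pair C X Y f g \<longleftrightarrow> f \<in> hom C X Y \<and> g \<in> hom C Y X \<and>
     cmp C X Y X g f = idn C X \<and> cmp C Y X Y f g = idn C Y"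

definition inverse_of :: "('o, 'm, 'z) cat_data_scheme \<Rightarrow> 'o \<Rightarrow> 'o \<Rightarrow> 'm \<Rightarrow> 'm" where
  "inverse_of C X Y f = (THE g. inverse_pair C X Y f g)"

context category
begin

lemma inverse_pair_unique:
  assumes "inverse_pair C X Y f g" "inverse_pair C X Y f g'"
  shows "g = g'"
proof -
  have h: "f \<in> hom C X Y" "g \<in> hom C Y X" "g' \<in> hom C Y X"
    using assms by (auto simp: inverse_pair_def)
  have "g = cmp C Y X X (cmp C X Y X g' f) g"
    using assms(2) h by (simp add: inverse_pair_def cmp_idn_left)
  also have "\<dots> = cmp C Y Y X g' (cmp C Y X Y f g)"
    using h(2,1,3) by (rule cmp_assoc)
  also have "\<dots> = g'"
    using assms(1) h by (simp add: inverse_pair_def cmp_idn_right)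
  finally show ?thesis .
qed

lemma inverse_of_eq: "inverse_pair C X Y f g \<Longrightarrow> inverse_of C X Y f = g"
  unfolding inverse_of_def by (blast intro: the_equality inverse_pair_unique)

lemma inverse_pair_idn: "X \<in> obj C \<Longrightarrow> inverse_pair C X X (idn C X) (idn C X)"
  by (simp add: inverse_pair_def idn_hom cmp_idn_left[OF idn_hom])

lemma inverse_pair_cmp:
  assumes f: "inverse_pair C X Y f f'" and g: "inverse_pair C Y Z g g'"
  shows "inverse_pair C X Z (cmp C X Y Z g f) (cmp C Z Y X f' g')"
proof -
  have h: "f \<in> hom C X Y" "f' \<in> hom C Y X" "g \<in> hom C Y Z" "g' \<in> hom C Z Y"
    using f g by (auto simp: inverse_pair_def)
  have 1: "cmp C X Z Y g' (cmp C X Y Z g f) = f"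
    using cmp_assoc[OF h(1,3,4)] g h by (simp add: inverse_pair_def cmp_idn_left)
  have 2: "cmp C Z X Y f (cmp C Z Y X f' g') = g'"
    using cmp_assoc[OF h(4,2,1)] f h by (simp add: inverse_pair_def cmp_idn_left)
  show ?thesis
    using f g h cmp_assoc[OF cmp_hom[OF h(1,3)] h(4,2)] cmp_assoc[OF cmp_hom[OF h(4,2)] h(1,3)]
    by (simp add: inverse_pair_def cmp_hom 1 2)
qed

end

section \<open>Naturality of the maps between Yoneda presheaves\<close>

lemma (in category) yo_presheaf: "presheaf C (yo C X)"
  by unfold_locales (auto simp: yo_def hom_obj cmp_hom cmp_idn_right cmp_assoc)

lemma (in category) yo_map_nat_trans:
  assumes "f \<in> hom C X Y"
  shows "nat_trans C (yo C X) (yo C Y) (yo_map C X Y f)"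
  using yo_presheaf[of X] yo_presheaf[of Y] assms
  by (auto simp: nat_trans_def nat_trans_axioms_def yo_def yo_map_def cmp_hom cmp_assoc)

text \<open>Together with \<open>yo_map_nat_trans\<close> this supplies the naturality clauses of
  \<open>pullback_square\<close>, so that for the free model only bijectivity at each object has to
  be checked.\<close>

lemma (in presheaf) elt_map_nat_trans:
  assumes "x \<in> elts P X"
  shows "nat_trans C (yo C X) P (elt_map P X x)"
  using yo_presheaf[of X] presheaf_axioms assms
  by (auto simp: nat_trans_def nat_trans_axioms_def yo_def elt_map_def act_elts act_cmp)

section \<open>Pairing and lifting for context extensions\<close>

text \<open>The substitution <f, a> of a category with families, meaningful when a has type
  A[f].\<close>

definition ext_pair ::
    "('o, 'm, 'u, 'e, 'z) model_data_scheme \<Rightarrow> 'o \<Rightarrow> 'o \<Rightarrow> 'u \<Rightarrow> 'm \<Rightarrow> 'e \<Rightarrow> 'm" where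
  "ext_pair M \<Delta> \<Gamma> A f a = (THE h. h \<in> hom (base M) \<Delta> (ext M \<Gamma> A) \<and>
     cmp (base M) \<Delta> (ext M \<Gamma> A) \<Gamma> (prj M \<Gamma> A) h = f \<and>
     act (Tm M) \<Delta> (ext M \<Gamma> A) h (var M \<Gamma> A) = a)"

text \<open>The lift of f to the extensions, often written q(f, A): the top edge of the canonical
  square over f.\<close>

definition ext_map ::
    "('o, 'm, 'u, 'e, 'z) model_data_scheme \<Rightarrow> 'o \<Rightarrow> 'o \<Rightarrow> 'u \<Rightarrow> 'm \<Rightarrow> 'm" where
  "ext_map M \<Delta> \<Gamma> A f =
     (let B = act (Ty M) \<Delta> \<Gamma> f A; E = ext M \<Delta> B
      in ext_pair M E \<Gamma> A (cmp (base M) E \<Delta> \<Gamma> f (prj M \<Delta> B)) (var M \<Delta> B))"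

context natural_model
begin

text \<open>At one stage the pullback square is a bijection from maps into the extension to
  compatible pairs (f, a). Surjectivity gives existence, injectivity gives uniqueness.\<close>

lemma ext_pair_ex1:
  assumes A: "A \<in> elts (Ty M) \<Gamma>" and f: "f \<in> hom (base M) \<Delta> \<Gamma>"
    and a: "a \<in> elts (Tm M) \<Delta>" and ty: "ty_of M \<Delta> a = act (Ty M) \<Delta> \<Gamma> f A"
  shows "\<exists>!h. h \<in> hom (base M) \<Delta> (ext M \<Gamma> A) \<and>
     cmp (base M) \<Delta> (ext M \<Gamma> A) \<Gamma> (prj M \<Gamma> A) h = f \<and>
     act (Tm M) \<Delta> (ext M \<Gamma> A) h (var M \<Gamma> A) = a"
proof -
  have "\<Delta> \<in> obj (base M)" using f dom.hom_obj by blast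
  then have b: "bij_betw (\<lambda>h. (cmp (base M) \<Delta> (ext M \<Gamma> A) \<Gamma> (prj M \<Gamma> A) h,
        act (Tm M) \<Delta> (ext M \<Gamma> A) h (var M \<Gamma> A))) (hom (base M) \<Delta> (ext M \<Gamma> A))
      {(r, q). r \<in> hom (base M) \<Delta> \<Gamma> \<and> q \<in> elts (Tm M) \<Delta> \<and>
        act (Ty M) \<Delta> \<Gamma> r A = ty_of M \<Delta> q}"
    using ext_pullback[OF A] by (simp add: pullback_square_def yo_def yo_map_def elt_map_def)
  have "(f, a) \<in> {(r, q). r \<in> hom (base M) \<Delta> \<Gamma> \<and> q \<in> elts (Tm M) \<Delta> \<and>
        act (Ty M) \<Delta> \<Gamma> r A = ty_of M \<Delta> q}" using assms by simp
  then obtain h where h: "h \<in> hom (base M) \<Delta> (ext M \<Gamma> A)"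
      "cmp (base M) \<Delta> (ext M \<Gamma> A) \<Gamma> (prj M \<Gamma> A) h = f"
      "act (Tm M) \<Delta> (ext M \<Gamma> A) h (var M \<Gamma> A) = a"
    unfolding bij_betw_imp_surj_on[OF b, symmetric] by blast
  show ?thesis
    using h bij_betw_imp_inj_on[OF b] by (intro ex1I[of _ h]) (auto simp: inj_on_def)
qed

lemma ext_pair:
  assumes "A \<in> elts (Ty M) \<Gamma>" "f \<in> hom (base M) \<Delta> \<Gamma>"
    "a \<in> elts (Tm M) \<Delta>" "ty_of M \<Delta> a = act (Ty M) \<Delta> \<Gamma> f A"
  shows "ext_pair M \<Delta> \<Gamma> A f a \<in> hom (base M) \<Delta> (ext M \<Gamma> A)"
    and "cmp (base M) \<Delta> (ext M \<Gamma> A) \<Gamma> (prj M \<Gamma> A) (ext_pair M \<Delta> \<Gamma> A f a) = f"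
    and "act (Tm M) \<Delta> (ext M \<Gamma> A) (ext_pair M \<Delta> \<Gamma> A f a) (var M \<Gamma> A) = a"
  using theI'[OF ext_pair_ex1[OF assms]] by (simp_all add: ext_pair_def)

text \<open>The commuting square, evaluated at the identity of the extension.\<close>

lemma ty_of_var:
  assumes A: "A \<in> elts (Ty M) \<Gamma>"
  shows "ty_of M (ext M \<Gamma> A) (var M \<Gamma> A) = act (Ty M) (ext M \<Gamma> A) \<Gamma> (prj M \<Gamma> A) A"
proof -
  have i: "idn (base M) (ext M \<Gamma> A) \<in> hom (base M) (ext M \<Gamma> A) (ext M \<Gamma> A)"
    using ext_obj[OF A] by (rule dom.idn_hom)
  then show ?thesis
    using pullback_square_commutes[OF ext_pullback[OF A], of "idn (base M) (ext M \<Gamma> A)"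
        "ext M \<Gamma> A"]
    by (simp add: yo_def elt_map_def yo_map_def dom.act_idn[OF var_elts[OF A]]
        dom.cmp_idn_right[OF prj_hom[OF A]])
qed

text \<open>Projection and variable are jointly monic, because both maps are the pairing of the same
  data. The equalities of maps into an extension in this part rest on it.\<close>

lemma ext_hom_eqI:
  assumes A: "A \<in> elts (Ty M) \<Gamma>"
    and h: "h \<in> hom (base M) \<Delta> (ext M \<Gamma> A)" and h': "h' \<in> hom (base M) \<Delta> (ext M \<Gamma> A)"
    and p: "cmp (base M) \<Delta> (ext M \<Gamma> A) \<Gamma> (prj M \<Gamma> A) h =
      cmp (base M) \<Delta> (ext M \<Gamma> A) \<Gamma> (prj M \<Gamma> A) h'"
    and v: "act (Tm M) \<Delta> (ext M \<Gamma> A) h (var M \<Gamma> A) =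
      act (Tm M) \<Delta> (ext M \<Gamma> A) h' (var M \<Gamma> A)"
  shows "h = h'"
proof -
  let ?f = "cmp (base M) \<Delta> (ext M \<Gamma> A) \<Gamma> (prj M \<Gamma> A) h'"
  let ?a = "act (Tm M) \<Delta> (ext M \<Gamma> A) h' (var M \<Gamma> A)"
  \<comment> \<open>The components of any map into the extension are compatible: the variable has
    type A[p], and typing is natural.\<close>
  have "ty_of M \<Delta> ?a = act (Ty M) \<Delta> \<Gamma> ?f A"
    using A h' by (simp add: natural var_elts ty_of_var cod.act_cmp prj_hom)
  then have "\<exists>!h. h \<in> hom (base M) \<Delta> (ext M \<Gamma> A) \<and>
     cmp (base M) \<Delta> (ext M \<Gamma> A) \<Gamma> (prj M \<Gamma> A) h = ?f \<and>
     act (Tm M) \<Delta> (ext M \<Gamma> A) h (var M \<Gamma> A) = ?a"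
    using A h' by (intro ext_pair_ex1) (auto intro: dom.cmp_hom prj_hom dom.act_elts var_elts)
  then show ?thesis using h h' p v by blast
qed

context
  fixes \<Gamma> \<Delta> A f
  assumes A: "A \<in> elts (Ty M) \<Gamma>" and f: "f \<in> hom (base M) \<Delta> \<Gamma>"
begin

text \<open>Pairing applies because the variable of B has type B[p] = A[f][p] = A[f o p].\<close>

lemma ext_map:
  defines "B \<equiv> act (Ty M) \<Delta> \<Gamma> f A"
  shows "ext_map M \<Delta> \<Gamma> A f \<in> hom (base M) (ext M \<Delta> B) (ext M \<Gamma> A)"
    and "cmp (base M) (ext M \<Delta> B) (ext M \<Gamma> A) \<Gamma> (prj M \<Gamma> A) (ext_map M \<Delta> \<Gamma> A f) =
      cmp (base M) (ext M \<Delta> B) \<Delta> \<Gamma> f (prj M \<Delta> B)"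
    and "act (Tm M) (ext M \<Delta> B) (ext M \<Gamma> A) (ext_map M \<Delta> \<Gamma> A f) (var M \<Gamma> A) = var M \<Delta> B"
proof -
  have B: "B \<in> elts (Ty M) \<Delta>" unfolding B_def by (rule cod.act_elts[OF f A])
  have ty: "ty_of M (ext M \<Delta> B) (var M \<Delta> B) =
      act (Ty M) (ext M \<Delta> B) \<Gamma> (cmp (base M) (ext M \<Delta> B) \<Delta> \<Gamma> f (prj M \<Delta> B)) A"
    using ty_of_var[OF B] cod.act_cmp[OF prj_hom[OF B] f A] by (simp add: B_def)
  note e = ext_pair[OF A dom.cmp_hom[OF prj_hom[OF B] f] var_elts[OF B] ty]
  show "ext_map M \<Delta> \<Gamma> A f \<in> hom (base M) (ext M \<Delta> B) (ext M \<Gamma> A)"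
    "cmp (base M) (ext M \<Delta> B) (ext M \<Gamma> A) \<Gamma> (prj M \<Gamma> A) (ext_map M \<Delta> \<Gamma> A f) =
      cmp (base M) (ext M \<Delta> B) \<Delta> \<Gamma> f (prj M \<Delta> B)"
    "act (Tm M) (ext M \<Delta> B) (ext M \<Gamma> A) (ext_map M \<Delta> \<Gamma> A f) (var M \<Gamma> A) = var M \<Delta> B"
    using e by (simp_all add: ext_map_def Let_def B_def)
qed

text \<open>In the uniqueness proof this recognises a comparison map coming from an arbitrary
  extension of F as the lift that the recursion prescribes.\<close>

lemma ext_map_eqI:
  defines "B \<equiv> act (Ty M) \<Delta> \<Gamma> f A"
  assumes "h \<in> hom (base M) (ext M \<Delta> B) (ext M \<Gamma> A)"
    and "cmp (base M) (ext M \<Delta> B) (ext M \<Gamma> A) \<Gamma> (prj M \<Gamma> A) h =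
      cmp (base M) (ext M \<Delta> B) \<Delta> \<Gamma> f (prj M \<Delta> B)"
    and "act (Tm M) (ext M \<Delta> B) (ext M \<Gamma> A) h (var M \<Gamma> A) = var M \<Delta> B"
  shows "h = ext_map M \<Delta> \<Gamma> A f"
  by (rule ext_hom_eqI[OF A assms(2)[unfolded B_def] ext_map(1)])
    (simp_all only: assms(3,4)[unfolded B_def] ext_map)

end

text \<open>The identity fixes projection and variable too, so joint monicity decides. This is how
  inverse laws are verified for maps of extensions.\<close>

lemma ext_endo_eq_idn:
  assumes "A \<in> elts (Ty M) \<Gamma>" "h \<in> hom (base M) (ext M \<Gamma> A) (ext M \<Gamma> A)"
    "cmp (base M) (ext M \<Gamma> A) (ext M \<Gamma> A) \<Gamma> (prj M \<Gamma> A) h = prj M \<Gamma> A"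
    "act (Tm M) (ext M \<Gamma> A) (ext M \<Gamma> A) h (var M \<Gamma> A) = var M \<Gamma> A"
  shows "h = idn (base M) (ext M \<Gamma> A)"
  by (rule ext_hom_eqI[OF assms(1,2)])
    (use assms in \<open>simp_all add: ext_obj dom.idn_hom dom.cmp_idn_right[OF prj_hom]
      dom.act_idn[OF var_elts]\<close>)

text \<open>As A[id] = A, the lift is an endomap of a single extension. The invariance of the
  interpretation under the identification of contexts depends on this.\<close>

lemma ext_map_idn:
  assumes A: "A \<in> elts (Ty M) \<Gamma>"
  shows "ext_map M \<Gamma> \<Gamma> A (idn (base M) \<Gamma>) = idn (base M) (ext M \<Gamma> A)"
proof (rule ext_endo_eq_idn[OF A])
  have i: "idn (base M) \<Gamma> \<in> hom (base M) \<Gamma> \<Gamma>"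
    using A cod.elts_obj dom.idn_hom by blast
  note e = ext_map[OF A i, unfolded cod.act_idn[OF A]]
  show "ext_map M \<Gamma> \<Gamma> A (idn (base M) \<Gamma>) \<in> hom (base M) (ext M \<Gamma> A) (ext M \<Gamma> A)"
    by (rule e)
  show "cmp (base M) (ext M \<Gamma> A) (ext M \<Gamma> A) \<Gamma> (prj M \<Gamma> A)
      (ext_map M \<Gamma> \<Gamma> A (idn (base M) \<Gamma>)) = prj M \<Gamma> A"
    using e(2) by (simp add: dom.cmp_idn_left[OF prj_hom[OF A]])
  show "act (Tm M) (ext M \<Gamma> A) (ext M \<Gamma> A) (ext_map M \<Gamma> \<Gamma> A (idn (base M) \<Gamma>))
      (var M \<Gamma> A) = var M \<Gamma> A"
    by (rule e)
qed

text \<open>The inverse is the lift of g. It is written as a pairing, so that its source is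
  literally the extension by A and not the one by A[f][g].\<close>

lemma ext_map_inverse_pair:
  assumes A: "A \<in> elts (Ty M) \<Gamma>" and fg: "inverse_pair (base M) \<Delta> \<Gamma> f g"
  shows "\<exists>h. inverse_pair (base M) (ext M \<Delta> (act (Ty M) \<Delta> \<Gamma> f A)) (ext M \<Gamma> A)
    (ext_map M \<Delta> \<Gamma> A f) h"
proof -
  define B where "B = act (Ty M) \<Delta> \<Gamma> f A"
  have f: "f \<in> hom (base M) \<Delta> \<Gamma>" and g: "g \<in> hom (base M) \<Gamma> \<Delta>"
    using fg by (auto simp: inverse_pair_def)
  have B: "B \<in> elts (Ty M) \<Delta>" unfolding B_def by (rule cod.act_elts[OF f A])
  let ?G = "ext M \<Gamma> A" and ?D = "ext M \<Delta> B"
  let ?p = "prj M \<Gamma> A" and ?p' = "prj M \<Delta> B"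
  have p: "?p \<in> hom (base M) ?G \<Gamma>" and p': "?p' \<in> hom (base M) ?D \<Delta>"
    using A B prj_hom by auto
  have fgk: "cmp (base M) X \<Delta> \<Gamma> f (cmp (base M) X \<Gamma> \<Delta> g k) = k"
    if "k \<in> hom (base M) X \<Gamma>" for X k
    using dom.cmp_assoc[OF that g f] fg that by (simp add: inverse_pair_def dom.cmp_idn_left)
  have gfk: "cmp (base M) X \<Gamma> \<Delta> g (cmp (base M) X \<Delta> \<Gamma> f k) = k"
    if "k \<in> hom (base M) X \<Delta>" for X k
    using dom.cmp_assoc[OF that f g] fg that by (simp add: inverse_pair_def dom.cmp_idn_left)
  let ?e = "ext_map M \<Delta> \<Gamma> A f"
  note e = ext_map[OF A f, folded B_def]
  let ?gp = "cmp (base M) ?G \<Gamma> \<Delta> g ?p"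
  have gp: "?gp \<in> hom (base M) ?G \<Delta>" using p g by (rule dom.cmp_hom)
  \<comment> \<open>A[p] = B[g o p], since B = A[f] and f o g is the identity.\<close>
  have ty: "ty_of M ?G (var M \<Gamma> A) = act (Ty M) ?G \<Delta> ?gp B"
    unfolding B_def cod.act_cmp[OF gp f A, symmetric] fgk[OF p] by (rule ty_of_var[OF A])
  define h where "h = ext_pair M ?G \<Delta> B ?gp (var M \<Gamma> A)"
  note h = ext_pair[OF B gp var_elts[OF A] ty, folded h_def]
  have "cmp (base M) ?D ?G ?D h ?e = idn (base M) ?D"
  proof (rule ext_endo_eq_idn[OF B])
    show "cmp (base M) ?D ?G ?D h ?e \<in> hom (base M) ?D ?D" using e(1) h(1) by (rule dom.cmp_hom)
    \<comment> \<open>Reassociating twice: p' o (h o e) = (g o p) o e = g o (f o p') = p'.\<close>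
    show "cmp (base M) ?D ?D \<Delta> ?p' (cmp (base M) ?D ?G ?D h ?e) = ?p'"
      using e(1,2) h(1,2) p p' g by (simp flip: dom.cmp_assoc) (simp add: dom.cmp_assoc gfk)
    show "act (Tm M) ?D ?D (cmp (base M) ?D ?G ?D h ?e) (var M \<Delta> B) = var M \<Delta> B"
      using e h B by (simp add: dom.act_cmp var_elts)
  qed
  moreover have "cmp (base M) ?G ?D ?G ?e h = idn (base M) ?G"
  proof (rule ext_endo_eq_idn[OF A])
    show "cmp (base M) ?G ?D ?G ?e h \<in> hom (base M) ?G ?G" using h(1) e(1) by (rule dom.cmp_hom)
    show "cmp (base M) ?G ?G \<Gamma> ?p (cmp (base M) ?G ?D ?G ?e h) = ?p"
      using e(1,2) h(1,2) p p' f by (simp flip: dom.cmp_assoc) (simp add: dom.cmp_assoc fgk)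
    show "act (Tm M) ?G ?G (cmp (base M) ?G ?D ?G ?e h) (var M \<Gamma> A) = var M \<Gamma> A"
      using e h A by (simp add: dom.act_cmp var_elts)
  qed
  ultimately show ?thesis using e(1) h(1) by (auto simp: inverse_pair_def B_def)
qed

end

section \<open>The terminal object and the unit type in an arbitrary context\<close>

definition to_trm :: "('o, 'm, 'u, 'e, 'z) model_data_scheme \<Rightarrow> 'o \<Rightarrow> 'm" where
  "to_trm M X = (THE f. f \<in> hom (base M) X (trm M))"

context natural_model
begin

lemma trm_obj: "trm M \<in> obj (base M)"
  using trm_terminal by (simp add: terminal_def)

lemma to_trm_hom: "X \<in> obj (base M) \<Longrightarrow> to_trm M X \<in> hom (base M) X (trm M)"
  unfolding to_trm_def
  by (rule theI'[of "\<lambda>f. f \<in> hom (base M) X (trm M)"])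
    (use trm_terminal in \<open>simp add: terminal_def\<close>)

lemma to_trm_eq: "f \<in> hom (base M) X (trm M) \<Longrightarrow> f = to_trm M X"
  using trm_terminal to_trm_hom[of X] dom.hom_obj[of f X "trm M"] by (auto simp: terminal_def)

end

text \<open>The structure is given only over the terminal object; weakening carries it to X.\<close>

definition unit_ty_at :: "('o, 'm, 'u, 'e, 'z) unit_model_data_scheme \<Rightarrow> 'o \<Rightarrow> 'u" where
  "unit_ty_at M X = act (Ty M) X (trm M) (to_trm M X) (unit_ty M)"

definition unit_tm_at :: "('o, 'm, 'u, 'e, 'z) unit_model_data_scheme \<Rightarrow> 'o \<Rightarrow> 'e" where
  "unit_tm_at M X = act (Tm M) X (trm M) (to_trm M X) (unit_tm M)"

context unit_natural_model
begin

lemma unit_ty_at_elts: "X \<in> obj (base M) \<Longrightarrow> unit_ty_at M X \<in> elts (Ty M) X"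
  unfolding unit_ty_at_def by (intro cod.act_elts to_trm_hom unit_ty_elts)

lemma unit_tm_at_elts: "X \<in> obj (base M) \<Longrightarrow> unit_tm_at M X \<in> elts (Tm M) X"
  unfolding unit_tm_at_def by (intro dom.act_elts to_trm_hom unit_tm_elts)

lemma unit_ty_at_trm: "unit_ty_at M (trm M) = unit_ty M"
  using to_trm_eq[OF dom.idn_hom[OF trm_obj]] cod.act_idn[OF unit_ty_elts]
  by (simp add: unit_ty_at_def)

lemma unit_tm_at_trm: "unit_tm_at M (trm M) = unit_tm M"
  using to_trm_eq[OF dom.idn_hom[OF trm_obj]] dom.act_idn[OF unit_tm_elts]
  by (simp add: unit_tm_at_def)

text \<open>There is only one map from Y to the terminal object, so it agrees with the one that
  passes through f. Hence the unit type is stable under substitution.\<close>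

lemma act_unit_ty_at:
  assumes f: "f \<in> hom (base M) Y X"
  shows "act (Ty M) Y X f (unit_ty_at M X) = unit_ty_at M Y"
proof -
  have t: "to_trm M X \<in> hom (base M) X (trm M)" using f dom.hom_obj to_trm_hom by blast
  show ?thesis
    unfolding unit_ty_at_def cod.act_cmp[OF f t unit_ty_elts, symmetric]
    by (simp add: to_trm_eq[OF dom.cmp_hom[OF f t]])
qed

lemma act_unit_tm_at:
  assumes f: "f \<in> hom (base M) Y X"
  shows "act (Tm M) Y X f (unit_tm_at M X) = unit_tm_at M Y"
proof -
  have t: "to_trm M X \<in> hom (base M) X (trm M)" using f dom.hom_obj to_trm_hom by blast
  show ?thesis
    unfolding unit_tm_at_def dom.act_cmp[OF f t unit_tm_elts, symmetric]
    by (simp add: to_trm_eq[OF dom.cmp_hom[OF f t]])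
qed

lemma ty_of_unit_tm_at:
  assumes X: "X \<in> obj (base M)"
  shows "ty_of M X (unit_tm_at M X) = unit_ty_at M X"
  using pullback_square_commutes[OF unit_pullback, of "to_trm M X" X] to_trm_hom[OF X]
  by (simp add: yo_def elt_map_def unit_ty_at_def unit_tm_at_def)

text \<open>The eta rule. The left edge of the unit square is an identity, so at stage X every
  compatible pair consists of a map to the terminal object and the restriction of the unit term
  along it; that map is unique.\<close>

lemma unit_tm_at_unique:
  assumes a: "a \<in> elts (Tm M) X" and ty: "ty_of M X a = unit_ty_at M X"
  shows "a = unit_tm_at M X"
proof -
  have X: "X \<in> obj (base M)" using a dom.elts_obj by blast
  have b: "bij_betw (\<lambda>f. (f, act (Tm M) X (trm M) f (unit_tm M))) (hom (base M) X (trm M))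
      {(r, q). r \<in> hom (base M) X (trm M) \<and> q \<in> elts (Tm M) X \<and>
        act (Ty M) X (trm M) r (unit_ty M) = ty_of M X q}"
    using unit_pullback X by (simp add: pullback_square_def yo_def elt_map_def)
  have "(to_trm M X, a) \<in> {(r, q). r \<in> hom (base M) X (trm M) \<and> q \<in> elts (Tm M) X \<and>
        act (Ty M) X (trm M) r (unit_ty M) = ty_of M X q}"
    using a ty to_trm_hom[OF X] by (simp add: unit_ty_at_def)
  then show ?thesis
    unfolding bij_betw_imp_surj_on[OF b, symmetric] by (auto simp: unit_tm_at_def)
qed

text \<open>The type of the variable is the restricted unit type, that is, the unit type of the
  extended context, which has only one term.\<close>

lemma var_unit_ty_at:
  assumes X: "X \<in> obj (base M)"
  shows "var M X (unit_ty_at M X) = unit_tm_at M (ext M X (unit_ty_at M X))"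
  using ty_of_var[OF unit_ty_at_elts[OF X]] act_unit_ty_at[OF prj_hom[OF unit_ty_at_elts[OF X]]]
  by (intro unit_tm_at_unique var_elts unit_ty_at_elts X) simp

text \<open>The inverse is the section <id, star>. One composite is an identity by construction of
  the pairing; the other fixes the variable because a context has only one term of unit
  type.\<close>

lemma prj_unit_inverse_pair:
  assumes X: "X \<in> obj (base M)"
  shows "\<exists>s. inverse_pair (base M) (ext M X (unit_ty_at M X)) X (prj M X (unit_ty_at M X)) s"
proof -
  let ?u = "unit_ty_at M X" let ?E = "ext M X ?u" let ?p = "prj M X ?u"
  have u: "?u \<in> elts (Ty M) X" by (rule unit_ty_at_elts[OF X])
  note i = dom.idn_hom[OF X] and p = prj_hom[OF u]
  define s where "s = ext_pair M X X ?u (idn (base M) X) (unit_tm_at M X)"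
  have s: "s \<in> hom (base M) X ?E" "cmp (base M) X ?E X ?p s = idn (base M) X"
    "act (Tm M) X ?E s (var M X ?u) = unit_tm_at M X"
    using ext_pair[OF u i unit_tm_at_elts[OF X]] ty_of_unit_tm_at[OF X] act_unit_ty_at[OF i]
    by (simp_all add: s_def)
  have "cmp (base M) ?E X ?E s ?p = idn (base M) ?E"
  proof (rule ext_endo_eq_idn[OF u])
    show sp: "cmp (base M) ?E X ?E s ?p \<in> hom (base M) ?E ?E" using p s(1) by (rule dom.cmp_hom)
    show "cmp (base M) ?E ?E X ?p (cmp (base M) ?E X ?E s ?p) = ?p"
      using s p by (simp flip: dom.cmp_assoc add: dom.cmp_idn_left)
    show "act (Tm M) ?E ?E (cmp (base M) ?E X ?E s ?p) (var M X ?u) = var M X ?u"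
      using sp by (simp add: var_unit_ty_at[OF X] act_unit_tm_at)
  qed
  then show ?thesis using s p by (auto simp: inverse_pair_def)
qed

end

section \<open>Contexts of the free model and their classes\<close>

text \<open>The function that \<open>flat\<close> applies to representatives, named so that
  invariance under the identification can be stated for it.\<close>

fun ctx_flat :: "('o, 'm, 'u, 'e, 'z) model_data_scheme \<Rightarrow> ('o, 'u) unit_ctx \<Rightarrow> 'o" where
  "ctx_flat M (\<Gamma>, k, As) = ext_tel M \<Gamma> As"

text \<open>Telescopes recurse from the left while context extension acts at the right end; the snoc
  lemmas mediate between the two.\<close>

lemma ext_tel_snoc: "ext_tel M \<Gamma> (As @ [(A, k)]) = ext M (ext_tel M \<Gamma> As) A"
  by (induction M \<Gamma> As rule: ext_tel.induct) auto

lemma obj_free_cat: "obj (free_cat M) = unit_ctxs M // ctx_rel M"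
  by (simp add: free_cat_def)

lemma free_unit_model_simps [simp]:
  "base (free_unit_model M) = free_cat M"
  "trm (free_unit_model M) = ctx_class M (trm M, 0, [])"
  "Ty (free_unit_model M) = free_psh M (Ty M)"
  "Tm (free_unit_model M) = free_psh M (Tm M)"
  "ty_of (free_unit_model M) = (\<lambda>X. map_option (ty_of M (flat M X)))"
  "prj (free_unit_model M) X None = idn (base M) (flat M X)"
  "prj (free_unit_model M) X (Some B) = prj M (flat M X) B"
  "var (free_unit_model M) X A = map_option (var M (flat M X)) A"
  "unit_ty (free_unit_model M) = None"
  "unit_tm (free_unit_model M) = None"
  by (simp_all add: free_unit_model_def)

lemma free_cat_simps:
  "hom (free_cat M) X Y =
    (if X \<in> obj (free_cat M) \<and> Y \<in> obj (free_cat M)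
     then hom (base M) (flat M X) (flat M Y) else {})"
  "idn (free_cat M) X = idn (base M) (flat M X)"
  "cmp (free_cat M) X Y Z = cmp (base M) (flat M X) (flat M Y) (flat M Z)"
  by (simp_all add: free_cat_def)

lemma free_psh_simps:
  "elts (free_psh M P) X =
    (if X \<in> obj (free_cat M) then insert None (Some ` elts P (flat M X)) else {})"
  "act (free_psh M P) Y X \<sigma> = map_option (act P (flat M Y) (flat M X) \<sigma>)"
  by (simp_all add: free_psh_def)

context natural_model
begin

lemma ctx_rel_equiv: "equiv (unit_ctxs M) (ctx_rel M)"
proof (rule equivI)
  show "trans (ctx_rel M)"
    unfolding ctx_rel_def trans_def by (blast intro: equivclp_trans)
qed (auto simp: ctx_rel_def refl_on_def sym_def intro: equivclp_sym)

lemma ctx_class_eq_iff: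
  "x \<in> unit_ctxs M \<Longrightarrow> y \<in> unit_ctxs M \<Longrightarrow>
    ctx_class M x = ctx_class M y \<longleftrightarrow> (x, y) \<in> ctx_rel M"
  unfolding ctx_class_def by (rule eq_equiv_class_iff[OF ctx_rel_equiv])

lemma absorb_unit_ctxs: "absorb M x y \<Longrightarrow> x \<in> unit_ctxs M \<and> y \<in> unit_ctxs M"
  by (auto elim!: absorb.cases simp: unit_ctxs_def)

lemma absorb_ctx_class: "absorb M x y \<Longrightarrow> ctx_class M x = ctx_class M y"
  using absorb_unit_ctxs[of x y] by (auto simp: ctx_class_eq_iff ctx_rel_def)

lemma absorb_ctx_flat: "absorb M x y \<Longrightarrow> ctx_flat M x = ctx_flat M y"
  by (auto elim!: absorb.cases)

text \<open>Induction along a zigzag of absorptions, all of which keep the underlying context.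
  Testing h only on steps over that context matters for adding a type A, which is compatible with
  absorption where A lives.\<close>

lemma ctx_rel_invariant:
  assumes "(x, y) \<in> ctx_rel M"
    and inv: "\<And>u v. absorb M u v \<Longrightarrow> ctx_flat M u = ctx_flat M x \<Longrightarrow> h u = h v"
  shows "h y = h x"
proof -
  have "equivclp (absorb M) x y" using assms by (simp add: ctx_rel_def)
  then have "ctx_flat M y = ctx_flat M x \<and> h y = h x"
  proof (induction rule: equivclp_induct)
    case base
    then show ?case by simp
  next
    case (step y z)
    then show ?case using inv[of y z] inv[of z y] absorb_ctx_flat[of y z] absorb_ctx_flat[of z y]
      by auto
  qed
  then show ?thesis by simp
qed

text \<open>This is what lets operations on classes be computed at a representative:
  \<open>flat\<close> and the interpretation extract the element of such an image, and context
  extension takes its union.\<close>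

lemma image_ctx_class:
  assumes "x \<in> unit_ctxs M"
    and "\<And>u v. absorb M u v \<Longrightarrow> ctx_flat M u = ctx_flat M x \<Longrightarrow> h u = h v"
  shows "h ` ctx_class M x = {h x}"
proof -
  have "x \<in> ctx_class M x"
    unfolding ctx_class_def by (rule equiv_class_self[OF ctx_rel_equiv assms(1)])
  moreover have "h y = h x" if "y \<in> ctx_class M x" for y
    by (rule ctx_rel_invariant[OF _ assms(2)]) (use that in \<open>auto simp: ctx_class_def\<close>)
  ultimately show ?thesis by blast
qed

lemma flat_ctx_class: "x \<in> unit_ctxs M \<Longrightarrow> flat M (ctx_class M x) = ctx_flat M x"
proof -
  assume "x \<in> unit_ctxs M"
  moreover have "(\<lambda>(\<Gamma>, k, As). ext_tel M \<Gamma> As) = ctx_flat M" by (auto simp: fun_eq_iff)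
  ultimately show ?thesis
    using image_ctx_class[of x "ctx_flat M"] by (simp add: flat_def absorb_ctx_flat)
qed

lemma valid_tel_obj: "valid_tel M \<Gamma> As \<Longrightarrow> \<Gamma> \<in> obj (base M) \<and> ext_tel M \<Gamma> As \<in> obj (base M)"
  by (induction As arbitrary: \<Gamma>) (auto simp: cod.elts_obj)

lemma valid_tel_snoc:
  "valid_tel M \<Gamma> (As @ [(A, k)]) \<longleftrightarrow>
    valid_tel M \<Gamma> As \<and> A \<in> elts (Ty M) (ext_tel M \<Gamma> As)"
  by (induction As arbitrary: \<Gamma>) (auto simp: cod.elts_obj ext_obj)

lemma valid_tel_snocI:
  "valid_tel M \<Gamma> As \<Longrightarrow> A \<in> elts (Ty M) (ext_tel M \<Gamma> As) \<Longrightarrow> valid_tel M \<Gamma> (As @ [(A, k)])"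
  by (simp add: valid_tel_snoc cod.elts_obj ext_obj)

lemma add_unit_snoc: "add_unit (\<Gamma>, k, As @ [(A, l)]) = (\<Gamma>, k, As @ [(A, Suc l)])"
  by simp

lemma add_unit_unit_ctxs: "x \<in> unit_ctxs M \<Longrightarrow> add_unit x \<in> unit_ctxs M"
  by (cases x; rule rev_cases[of "snd (snd x)"])
    (auto simp: unit_ctxs_def valid_tel_snoc cod.elts_obj simp del: add_unit.simps
      simp add: add_unit_snoc add_unit.simps[of _ _ "[]"])

lemma add_ty_unit_ctxs:
  "x \<in> unit_ctxs M \<Longrightarrow> A \<in> elts (Ty M) (ctx_flat M x) \<Longrightarrow> add_ty A x \<in> unit_ctxs M"
  by (cases x) (auto simp: unit_ctxs_def valid_tel_snocI)

lemma ctx_flat_add_unit: "ctx_flat M (add_unit x) = ctx_flat M x"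
  by (cases x; rule rev_cases[of "snd (snd x)"]) (auto simp: ext_tel_snoc)

lemma ctx_flat_add_ty: "ctx_flat M (add_ty A x) = ext M (ctx_flat M x) A"
  by (cases x) (auto simp: ext_tel_snoc)

text \<open>When the absorbed type is the last entry, its counter becomes the leading counter of the
  shorter list, and these are the two counters that \<open>add_unit\<close> raises. Otherwise
  absorption leaves the last entry alone.\<close>

lemma absorb_add_unit:
  assumes "absorb M x y"
  shows "absorb M (add_unit x) (add_unit y)"
  using assms
proof cases
  case (1 \<Gamma> A k As)
  show ?thesis
  proof (cases As rule: rev_cases)
    case Nil
    then show ?thesis using 1 by (auto intro: absorb.intros)
  next
    case (snoc Bs b)
    then obtain B l where b: "b = (B, l)" by (cases b)
    have "valid_tel M \<Gamma> (((A, k) # Bs) @ [(B, Suc l)])"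
      using 1 snoc b valid_tel_snoc[of \<Gamma> "(A, k) # Bs" B l]
        valid_tel_snoc[of \<Gamma> "(A, k) # Bs" B "Suc l"] by simp
    then show ?thesis using 1 snoc b by (auto intro: absorb.intros)
  qed
qed

lemma absorb_add_ty:
  assumes "absorb M x y" "B \<in> elts (Ty M) (ctx_flat M x)"
  shows "absorb M (add_ty B x) (add_ty B y)"
  using assms
proof cases
  case (1 \<Gamma> A k As)
  have "valid_tel M \<Gamma> (((A, k) # As) @ [(B, 0)])"
    using 1 assms(2) by (intro valid_tel_snocI) auto
  then show ?thesis using 1 by (auto intro: absorb.intros)
qed

lemma ext_None_ctx_class:
  assumes "x \<in> unit_ctxs M"
  shows "ext (free_unit_model M) (ctx_class M x) None = ctx_class M (add_unit x)"
proof -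
  have "(\<lambda>x. ctx_class M (add_unit x)) ` ctx_class M x = {ctx_class M (add_unit x)}"
    using assms by (intro image_ctx_class absorb_ctx_class absorb_add_unit)
  then show ?thesis by (simp add: free_unit_model_def)
qed

lemma ext_Some_ctx_class:
  assumes "x \<in> unit_ctxs M" "A \<in> elts (Ty M) (ctx_flat M x)"
  shows "ext (free_unit_model M) (ctx_class M x) (Some A) = ctx_class M (add_ty A x)"
proof -
  have "(\<lambda>x. ctx_class M (add_ty A x)) ` ctx_class M x = {ctx_class M (add_ty A x)}"
    using assms by (intro image_ctx_class absorb_ctx_class absorb_add_ty) auto
  then show ?thesis by (simp add: free_unit_model_def)
qed

lemma ctx_class_obj: "x \<in> unit_ctxs M \<Longrightarrow> ctx_class M x \<in> obj (free_cat M)"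
  by (simp add: obj_free_cat ctx_class_def quotientI)

lemma free_objE:
  assumes "X \<in> obj (free_cat M)"
  obtains x where "x \<in> unit_ctxs M" "X = ctx_class M x"
  using assms by (auto simp: obj_free_cat ctx_class_def elim: quotientE)

lemma incl_unit_ctxs: "\<Gamma> \<in> obj (base M) \<Longrightarrow> (\<Gamma>, k, []) \<in> unit_ctxs M"
  by (simp add: unit_ctxs_def)

lemma flat_incl: "\<Gamma> \<in> obj (base M) \<Longrightarrow> flat M (ctx_class M (\<Gamma>, 0, [])) = \<Gamma>"
  by (simp add: flat_ctx_class incl_unit_ctxs)

lemma incl_obj: "\<Gamma> \<in> obj (base M) \<Longrightarrow> ctx_class M (\<Gamma>, 0, []) \<in> obj (free_cat M)"
  by (simp add: ctx_class_obj incl_unit_ctxs)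

lemma flat_obj: "X \<in> obj (free_cat M) \<Longrightarrow> flat M X \<in> obj (base M)"
  by (erule free_objE) (auto simp: flat_ctx_class unit_ctxs_def valid_tel_obj)

lemma free_ext_None:
  assumes "X \<in> obj (free_cat M)"
  shows "ext (free_unit_model M) X None \<in> obj (free_cat M)"
    and "flat M (ext (free_unit_model M) X None) = flat M X"
  using assms by (auto elim!: free_objE simp: ext_None_ctx_class flat_ctx_class ctx_flat_add_unit
      add_unit_unit_ctxs simp del: add_unit.simps intro!: ctx_class_obj)

lemma free_ext_Some:
  assumes "X \<in> obj (free_cat M)" "A \<in> elts (Ty M) (flat M X)"
  shows "ext (free_unit_model M) X (Some A) \<in> obj (free_cat M)"
    and "flat M (ext (free_unit_model M) X (Some A)) = ext M (flat M X) A"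
  using assms by (auto elim!: free_objE simp: ext_Some_ctx_class flat_ctx_class ctx_flat_add_ty
      add_ty_unit_ctxs simp del: add_ty.simps intro!: ctx_class_obj)

text \<open>The leading counter stands for that many unit extensions of an included object, and each
  later entry for one type extension followed by unit extensions. With this rule, properties of the
  interpretation are proved without handling lists.\<close>

lemma free_obj_induct [consumes 1, case_names incl unit ty]:
  assumes X: "X \<in> obj (free_cat M)"
    and incl: "\<And>\<Gamma>. \<Gamma> \<in> obj (base M) \<Longrightarrow> P (ctx_class M (\<Gamma>, 0, []))"
    and unit: "\<And>X. X \<in> obj (free_cat M) \<Longrightarrow> P X \<Longrightarrow> P (ext (free_unit_model M) X None)"
    and ty: "\<And>X A. X \<in> obj (free_cat M) \<Longrightarrow> A \<in> elts (Ty M) (flat M X) \<Longrightarrow> P X \<Longrightarrow>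
      P (ext (free_unit_model M) X (Some A))"
  shows "P X"
proof -
  have unit': "P (ctx_class M (add_unit x))" if "x \<in> unit_ctxs M" "P (ctx_class M x)" for x
    using unit[OF ctx_class_obj] that by (simp add: ext_None_ctx_class del: add_unit.simps)
  have ty': "P (ctx_class M (add_ty A x))"
    if "x \<in> unit_ctxs M" "A \<in> elts (Ty M) (ctx_flat M x)" "P (ctx_class M x)" for x A
    using ty[OF ctx_class_obj] that
    by (simp add: ext_Some_ctx_class flat_ctx_class del: add_ty.simps)
  have "P (ctx_class M (\<Gamma>, k, As))" if "valid_tel M \<Gamma> As" for \<Gamma> k As
    using that
  proof (induction As rule: rev_induct)
    case Nil
    then show ?case
      by (induction k) (use incl unit'[of "(\<Gamma>, _, [])"] in \<open>auto simp: unit_ctxs_def\<close>)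
  next
    case (snoc a As)
    obtain A l where a: "a = (A, l)" by (cases a)
    have v: "valid_tel M \<Gamma> As" "A \<in> elts (Ty M) (ext_tel M \<Gamma> As)"
      using snoc.prems by (auto simp: a valid_tel_snoc cod.elts_obj)
    have "P (ctx_class M (\<Gamma>, k, As @ [(A, l)]))"
    proof (induction l)
      case 0
      show ?case using ty'[of "(\<Gamma>, k, As)" A] v snoc.IH by (simp add: unit_ctxs_def)
    next
      case (Suc l)
      then show ?case
        using unit'[of "(\<Gamma>, k, As @ [(A, l)])"] v
        by (simp add: unit_ctxs_def valid_tel_snocI)
    qed
    then show ?case by (simp add: a)
  qed
  then show ?thesis using X by (auto elim!: free_objE simp: unit_ctxs_def)
qed

section \<open>The free model is a natural model with a unit type\<close>

text \<open>Homs and composition are those of the given model read through \<open>flat\<close>, so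
  the laws are inherited.\<close>

lemma category_free_cat: "category (free_cat M)"
  by unfold_locales
    (auto simp: free_cat_simps flat_obj dom.idn_hom dom.cmp_idn_left dom.cmp_idn_right dom.cmp_assoc
      split: if_splits intro: dom.cmp_hom)

lemma presheaf_free_psh:
  assumes "presheaf (base M) P"
  shows "presheaf (free_cat M) (free_psh M P)"
proof -
  interpret P: presheaf "base M" P by (rule assms)
  interpret F: category "free_cat M" by (rule category_free_cat)
  show ?thesis
    by unfold_locales
      (auto simp: free_cat_simps free_psh_simps flat_obj P.act_elts P.act_idn P.act_cmp
        split: if_splits)
qed

lemma nat_trans_free:
  "nat_trans (free_cat M) (free_psh M (Tm M)) (free_psh M (Ty M))
    (\<lambda>X. map_option (ty_of M (flat M X)))"
  using presheaf_free_psh[OF dom.presheaf_axioms] presheaf_free_psh[OF cod.presheaf_axioms]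
  by (auto simp: nat_trans_def nat_trans_axioms_def free_cat_simps free_psh_simps component natural
      split: if_splits)

lemma free_terminal: "terminal (free_cat M) (ctx_class M (trm M, 0, []))"
  using trm_terminal
  by (auto simp: terminal_def free_cat_simps incl_obj flat_incl flat_obj)

lemma free_unit_natural_model: "unit_natural_model (free_unit_model M)"
proof -
  let ?N = "free_unit_model M" and ?ty = "\<lambda>X. map_option (ty_of M (flat M X))"
  interpret nt: nat_trans "free_cat M" "free_psh M (Tm M)" "free_psh M (Ty M)" ?ty
    by (rule nat_trans_free)
  \<comment> \<open>Naturality is settled here, leaving a bijection at each object. The left edge l
    stays general: it is a Yoneda map for extensions and the identity for the unit square.\<close>
  have pb: "pullback_square (free_cat M) (yo (free_cat M) E) (free_psh M (Tm M))
        (yo (free_cat M) X) (free_psh M (Ty M)) (elt_map (free_psh M (Tm M)) E v) l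
        ?ty (elt_map (free_psh M (Ty M)) X A)"
    if "A \<in> elts (free_psh M (Ty M)) X"
      "nat_trans (free_cat M) (yo (free_cat M) E) (yo (free_cat M) X) l"
      "v \<in> elts (free_psh M (Tm M)) E"
      "\<And>Y. Y \<in> obj (free_cat M) \<Longrightarrow>
        bij_betw (\<lambda>f. (l Y f, act (free_psh M (Tm M)) Y E f v)) (hom (free_cat M) Y E)
          {(r, q). r \<in> hom (free_cat M) Y X \<and> q \<in> elts (free_psh M (Tm M)) Y \<and>
            act (free_psh M (Ty M)) Y X r A = ?ty Y q}" for A X E l v
    unfolding pullback_square_def
    using nt.dom.elt_map_nat_trans[OF that(3)] nt.cod.elt_map_nat_trans[OF that(1)]
      that(2,4) nat_trans_free
    by (simp add: yo_def elt_map_def)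
  \<comment> \<open>Only the bullet term has the bullet as its type, so a compatible pair is
    determined by its first component. This covers both extension by the bullet and the unit
    square.\<close>
  have unit: "bij_betw (\<lambda>f. (l f, act (free_psh M (Tm M)) Y E f None)) (hom (free_cat M) Y E)
        {(r, q). r \<in> hom (free_cat M) Y X \<and> q \<in> elts (free_psh M (Tm M)) Y \<and>
            act (free_psh M (Ty M)) Y X r None = ?ty Y q}"
    if "X \<in> obj (free_cat M)" "E \<in> obj (free_cat M)" "Y \<in> obj (free_cat M)"
      "flat M E = flat M X" "\<And>f. f \<in> hom (base M) (flat M Y) (flat M X) \<Longrightarrow> l f = f"
    for X E Y l
    using that by (intro bij_betw_byWitness[where f' = fst])
      (auto simp: free_cat_simps free_psh_simps)
  \<comment> \<open>A term whose type is a \<open>Some\<close> is itself a \<open>Some\<close>, so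
    this is the square of the given model and pairing inverts it; \<open>the\<close> unwraps the
    term.\<close>
  have ty: "bij_betw (\<lambda>f. (cmp (free_cat M) Y E X (prj M (flat M X) A) f,
          act (free_psh M (Tm M)) Y E f (Some (var M (flat M X) A)))) (hom (free_cat M) Y E)
        {(r, q). r \<in> hom (free_cat M) Y X \<and> q \<in> elts (free_psh M (Tm M)) Y \<and>
            act (free_psh M (Ty M)) Y X r (Some A) = ?ty Y q}"
    if X: "X \<in> obj (free_cat M)" and A: "A \<in> elts (Ty M) (flat M X)"
      and E: "E \<in> obj (free_cat M)" "flat M E = ext M (flat M X) A"
      and Y: "Y \<in> obj (free_cat M)"
    for X E Y A
  proof -
    note e = ext_pair[OF A, of _ "flat M Y"]
    have inv: "ext_pair M (flat M Y) (flat M X) A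
        (cmp (base M) (flat M Y) (ext M (flat M X) A) (flat M X) (prj M (flat M X) A) h)
        (act (Tm M) (flat M Y) (ext M (flat M X) A) h (var M (flat M X) A)) = h"
      (is "ext_pair M _ _ A ?f ?a = h")
      if h: "h \<in> hom (base M) (flat M Y) (ext M (flat M X) A)" for h
    proof -
      have f: "?f \<in> hom (base M) (flat M Y) (flat M X)"
        using h prj_hom[OF A] by (rule dom.cmp_hom)
      have a: "?a \<in> elts (Tm M) (flat M Y)" using h var_elts[OF A] by (rule dom.act_elts)
      have t: "ty_of M (flat M Y) ?a = act (Ty M) (flat M Y) (flat M X) ?f A"
        using A h by (simp add: natural var_elts ty_of_var cod.act_cmp prj_hom)
      show ?thesis using ext_hom_eqI[OF A e(1)[OF f a t] h] e(2,3)[OF f a t] by simp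
    qed
    show ?thesis
      by (rule bij_betw_byWitness[where
            f' = "\<lambda>(r, q). ext_pair M (flat M Y) (flat M X) A r (the q)"])
        (use X E Y A inv e natural[OF _ var_elts[OF A]] in
          \<open>auto simp: free_cat_simps free_psh_simps prj_hom var_elts dom.act_elts ty_of_var
            cod.act_cmp intro: dom.cmp_hom\<close>)
  qed
  note T = incl_obj[OF trm_obj]
  show ?thesis
  proof (intro unit_natural_model.intro natural_model.intro natural_model_axioms.intro
      unit_natural_model_axioms.intro, unfold free_unit_model_simps)
    fix A \<Gamma> assume A: "A \<in> elts (free_psh M (Ty M)) \<Gamma>"
    then have \<Gamma>: "\<Gamma> \<in> obj (free_cat M)" by (rule nt.cod.elts_obj)
    show E: "ext ?N \<Gamma> A \<in> obj (free_cat M)"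
      using A \<Gamma> by (auto simp: free_psh_simps free_ext_None free_ext_Some)
    show p: "prj ?N \<Gamma> A \<in> hom (free_cat M) (ext ?N \<Gamma> A) \<Gamma>"
      using A \<Gamma> by (auto simp: free_psh_simps free_ext_None free_ext_Some free_cat_simps
          prj_hom dom.idn_hom flat_obj)
    show v: "map_option (var M (flat M \<Gamma>)) A \<in> elts (free_psh M (Tm M)) (ext ?N \<Gamma> A)"
      using A \<Gamma> by (auto simp: free_psh_simps free_ext_None free_ext_Some var_elts)
    show "pullback_square (free_cat M) (yo (free_cat M) (ext ?N \<Gamma> A)) (free_psh M (Tm M))
        (yo (free_cat M) \<Gamma>) (free_psh M (Ty M))
        (elt_map (free_psh M (Tm M)) (ext ?N \<Gamma> A) (map_option (var M (flat M \<Gamma>)) A))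
        (yo_map (free_cat M) (ext ?N \<Gamma> A) \<Gamma> (prj ?N \<Gamma> A)) ?ty
        (elt_map (free_psh M (Ty M)) \<Gamma> A)"
    proof (rule pb[OF A nt.dom.yo_map_nat_trans[OF p] v])
      fix Y assume Y: "Y \<in> obj (free_cat M)"
      show "bij_betw (\<lambda>f. (yo_map (free_cat M) (ext ?N \<Gamma> A) \<Gamma> (prj ?N \<Gamma> A) Y f,
            act (free_psh M (Tm M)) Y (ext ?N \<Gamma> A) f (map_option (var M (flat M \<Gamma>)) A)))
          (hom (free_cat M) Y (ext ?N \<Gamma> A))
          {(r, q). r \<in> hom (free_cat M) Y \<Gamma> \<and> q \<in> elts (free_psh M (Tm M)) Y \<and>
            act (free_psh M (Ty M)) Y \<Gamma> r A = ?ty Y q}"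
      proof (cases A)
        case None
        then show ?thesis using unit[OF \<Gamma> _ Y] free_ext_None[OF \<Gamma>]
          by (simp add: yo_map_def free_cat_simps dom.cmp_idn_left)
      next
        case (Some B)
        then have "B \<in> elts (Ty M) (flat M \<Gamma>)" using A \<Gamma> by (auto simp: free_psh_simps)
        then show ?thesis using ty[OF \<Gamma> _ _ _ Y] free_ext_Some[OF \<Gamma>] Some
          by (simp add: yo_map_def)
      qed
    qed
  next
    let ?T = "ctx_class M (trm M, 0, [])"
    show "terminal (free_cat M) ?T" by (rule free_terminal)
    show N: "None \<in> elts (free_psh M (Ty M)) ?T" and N': "None \<in> elts (free_psh M (Tm M)) ?T"
      using T by (simp_all add: free_psh_simps)
    show "pullback_square (free_cat M) (yo (free_cat M) ?T) (free_psh M (Tm M))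
        (yo (free_cat M) ?T) (free_psh M (Ty M)) (elt_map (free_psh M (Tm M)) ?T None)
        (\<lambda>_. id) ?ty (elt_map (free_psh M (Ty M)) ?T None)"
    proof (rule pb[OF N _ N' unit])
      show "nat_trans (free_cat M) (yo (free_cat M) ?T) (yo (free_cat M) ?T) (\<lambda>_. id)"
        using nt.dom.yo_presheaf[of ?T] by (simp add: nat_trans_def nat_trans_axioms_def)
    qed (use T in auto)
  qed (rule nat_trans_free)
qed

end

section \<open>Morphisms of natural models\<close>

context model_morphism
begin

lemma on_obj_in: "X \<in> obj (base M) \<Longrightarrow> on_obj F X \<in> obj (base N)"
  using on_obj by blast

lemma on_hom_in:
  "f \<in> hom (base M) X Y \<Longrightarrow> on_hom F X Y f \<in> hom (base N) (on_obj F X) (on_obj F Y)"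
  using on_hom by blast

lemma on_ty_in: "A \<in> elts (Ty M) \<Gamma> \<Longrightarrow> on_ty F \<Gamma> A \<in> elts (Ty N) (on_obj F \<Gamma>)"
  using on_ty by blast

lemma on_tm_in: "a \<in> elts (Tm M) \<Gamma> \<Longrightarrow> on_tm F \<Gamma> a \<in> elts (Tm N) (on_obj F \<Gamma>)"
  using on_tm by blast

lemma on_to_trm:
  "X \<in> obj (base M) \<Longrightarrow> on_hom F X (trm M) (to_trm M X) = to_trm N (on_obj F X)"
  using on_hom_in[OF dom.to_trm_hom] by (intro cod.to_trm_eq) (simp add: on_trm)

end

text \<open>Two codomains appear because the set in which a morphism takes its values depends on its
  own object part.\<close>

lemma PiE_eqI:
  "f \<in> S \<rightarrow>\<^sub>E T \<Longrightarrow> g \<in> S \<rightarrow>\<^sub>E T' \<Longrightarrow> (\<And>x. x \<in> S \<Longrightarrow> f x = g x) \<Longrightarrow> f = g"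
  by (auto simp: PiE_def intro: extensionalityI)

lemma model_morphism_map_eqI:
  assumes G: "model_morphism M N G" and H: "model_morphism M N H"
    and "\<And>X. X \<in> obj (base M) \<Longrightarrow> on_obj G X = on_obj H X"
    and "\<And>X Y f. f \<in> hom (base M) X Y \<Longrightarrow> on_hom G X Y f = on_hom H X Y f"
    and "\<And>X A. A \<in> elts (Ty M) X \<Longrightarrow> on_ty G X A = on_ty H X A"
    and "\<And>X a. a \<in> elts (Tm M) X \<Longrightarrow> on_tm G X a = on_tm H X a"
  shows "G = H"
proof -
  interpret G: model_morphism M N G by (rule G)
  interpret H: model_morphism M N H by (rule H)
  show ?thesis
  proof (rule map_data.equality)
    show "on_obj G = on_obj H" by (rule PiE_eqI[OF G.on_obj H.on_obj assms(3)])
    show "on_hom G = on_hom H"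
      by (rule ext, rule ext) (rule PiE_eqI[OF G.on_hom H.on_hom assms(4)])
    show "on_ty G = on_ty H" by (rule ext) (rule PiE_eqI[OF G.on_ty H.on_ty assms(5)])
    show "on_tm G = on_tm H" by (rule ext) (rule PiE_eqI[OF G.on_tm H.on_tm assms(6)])
  qed simp
qed

context unit_model_morphism
begin

text \<open>Preservation is demanded over the terminal object; naturality along the map to it
  spreads this to X.\<close>

lemma on_unit_ty_at:
  "X \<in> obj (base M) \<Longrightarrow> on_ty F X (unit_ty_at M X) = unit_ty_at N (on_obj F X)"
  by (simp add: unit_ty_at_def on_ty_natural dom.to_trm_hom dom.unit_ty_elts on_unit_ty on_trm
      on_to_trm)

lemma on_unit_tm_at:
  "X \<in> obj (base M) \<Longrightarrow> on_tm F X (unit_tm_at M X) = unit_tm_at N (on_obj F X)"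
  by (simp add: unit_tm_at_def on_tm_natural dom.to_trm_hom dom.unit_tm_elts on_unit_tm on_trm
      on_to_trm)

end

text \<open>Restriction fixes the bullet. Combined with the two preceding lemmas, this determines a
  unit preserving morphism on the bullet in every context.\<close>

lemma unit_at_free [simp]:
  "unit_ty_at (free_unit_model M) X = None"
  "unit_tm_at (free_unit_model M) X = None"
  by (simp_all add: unit_ty_at_def unit_tm_at_def free_psh_simps)

section \<open>Interpretation of contexts\<close>

locale unit_extension =
  C: natural_model C + D: unit_natural_model D + F: model_morphism C D F
  for C :: "('o, 'm, 'u, 'e, 'z) model_data_scheme"
    and D :: "('o2, 'm2, 'v, 'f, 'z2) unit_model_data_scheme"
    and F :: "('o, 'm, 'u, 'e, 'o2, 'm2, 'v, 'f) map_data"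
begin

text \<open>A context \<open>X\<close> of the free model is interpreted by an object of \<open>D\<close> together with an
  isomorphism from it to \<open>F\<close> applied to the underlying context \<open>flat C X\<close>.\<close>

definition unit_step :: "'o \<Rightarrow> 'o2 \<times> 'm2 \<Rightarrow> 'o2 \<times> 'm2" where
  "unit_step \<Gamma> s =
     (let X = fst s; u = unit_ty_at D X
      in (ext D X u, cmp (base D) (ext D X u) X (on_obj F \<Gamma>) (snd s) (prj D X u)))"

text \<open>The image of A under F lives over the target of the isomorphism, so it is restricted to
  the source before extending.\<close>

definition ty_step :: "'o \<Rightarrow> 'u \<Rightarrow> 'o2 \<times> 'm2 \<Rightarrow> 'o2 \<times> 'm2" where
  "ty_step \<Gamma> A s =
     (ext D (fst s) (act (Ty D) (fst s) (on_obj F \<Gamma>) (snd s) (on_ty F \<Gamma> A)),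
      ext_map D (fst s) (on_obj F \<Gamma>) (on_ty F \<Gamma> A) (snd s))"

text \<open>The context argument is the underlying context reached so far; the steps need it to name
  the target of the isomorphism.\<close>

fun tel_interp :: "'o \<Rightarrow> 'o2 \<times> 'm2 \<Rightarrow> ('u \<times> nat) list \<Rightarrow> 'o2 \<times> 'm2" where
  "tel_interp \<Gamma> s [] = s"
| "tel_interp \<Gamma> s ((A, k) # As) =
     tel_interp (ext C \<Gamma> A) ((unit_step (ext C \<Gamma> A) ^^ k) (ty_step \<Gamma> A s)) As"

fun ctx_interp :: "('o, 'u) unit_ctx \<Rightarrow> 'o2 \<times> 'm2" where
  "ctx_interp (\<Gamma>, k, As) =
     tel_interp \<Gamma> ((unit_step \<Gamma> ^^ k) (on_obj F \<Gamma>, idn (base D) (on_obj F \<Gamma>))) As"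

definition interp :: "('o, 'u) unit_ctx set \<Rightarrow> 'o2 \<times> 'm2" where
  "interp X = the_elem (ctx_interp ` X)"

lemma tel_interp_snoc:
  "tel_interp \<Gamma> s (As @ [(A, k)]) =
    (unit_step (ext C (ext_tel C \<Gamma> As) A) ^^ k)
      (ty_step (ext_tel C \<Gamma> As) A (tel_interp \<Gamma> s As))"
  by (induction \<Gamma> s As rule: tel_interp.induct) auto

lemma ctx_interp_add_unit: "ctx_interp (add_unit x) = unit_step (ctx_flat C x) (ctx_interp x)"
  by (cases x; rule rev_cases[of "snd (snd x)"])
    (auto simp: tel_interp_snoc ext_tel_snoc)

lemma ctx_interp_add_ty: "ctx_interp (add_ty A x) = ty_step (ctx_flat C x) A (ctx_interp x)"
  by (cases x) (simp add: tel_interp_snoc)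

lemma ty_step_idn:
  assumes A: "A \<in> elts (Ty C) \<Gamma>"
  shows "ty_step \<Gamma> A (on_obj F \<Gamma>, idn (base D) (on_obj F \<Gamma>)) =
    (on_obj F (ext C \<Gamma> A), idn (base D) (on_obj F (ext C \<Gamma> A)))"
  using F.on_ty_in[OF A]
  by (simp add: ty_step_def D.cod.act_idn D.ext_map_idn F.on_ext[OF A])

text \<open>With leading counter 0 the recursion starts at an identity. By
  \<open>ty_step_idn\<close> the first type then leads to the start state of the absorbing list, and
  from there both runs coincide.\<close>

lemma absorb_ctx_interp: "absorb C x y \<Longrightarrow> ctx_interp x = ctx_interp y"
  by (auto elim!: absorb.cases simp: ty_step_idn)

lemma interp_ctx_class: "x \<in> unit_ctxs C \<Longrightarrow> interp (ctx_class C x) = ctx_interp x"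
  using C.image_ctx_class[of x ctx_interp] by (simp add: interp_def absorb_ctx_interp)

lemma interp_incl:
  "\<Gamma> \<in> obj (base C) \<Longrightarrow>
    interp (ctx_class C (\<Gamma>, 0, [])) = (on_obj F \<Gamma>, idn (base D) (on_obj F \<Gamma>))"
  by (simp add: interp_ctx_class C.incl_unit_ctxs)

lemma interp_None:
  "X \<in> obj (free_cat C) \<Longrightarrow>
    interp (ext (free_unit_model C) X None) = unit_step (flat C X) (interp X)"
  by (auto elim!: C.free_objE simp: interp_ctx_class C.ext_None_ctx_class C.add_unit_unit_ctxs
      C.flat_ctx_class ctx_interp_add_unit simp del: add_unit.simps ctx_interp.simps)

lemma interp_Some:
  "X \<in> obj (free_cat C) \<Longrightarrow> A \<in> elts (Ty C) (flat C X) \<Longrightarrow>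
    interp (ext (free_unit_model C) X (Some A)) = ty_step (flat C X) A (interp X)"
  by (auto elim!: C.free_objE simp: interp_ctx_class C.ext_Some_ctx_class C.add_ty_unit_ctxs
      C.flat_ctx_class ctx_interp_add_ty simp del: add_ty.simps ctx_interp.simps)

abbreviation ob :: "('o, 'u) unit_ctx set \<Rightarrow> 'o2" where
  "ob X \<equiv> fst (interp X)"

abbreviation fl :: "('o, 'u) unit_ctx set \<Rightarrow> 'o2" where
  "fl X \<equiv> on_obj F (flat C X)"

abbreviation iso :: "('o, 'u) unit_ctx set \<Rightarrow> 'm2" where
  "iso X \<equiv> snd (interp X)"

abbreviation inv_iso :: "('o, 'u) unit_ctx set \<Rightarrow> 'm2" where
  "inv_iso X \<equiv> inverse_of (base D) (ob X) (fl X) (iso X)"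

lemma interp_iso:
  assumes "X \<in> obj (free_cat C)"
  shows "\<exists>g. inverse_pair (base D) (ob X) (fl X) (iso X) g"
  using assms
proof (induction rule: C.free_obj_induct)
  case (incl \<Gamma>)
  then show ?case
    using D.dom.inverse_pair_idn F.on_obj_in by (auto simp: interp_incl C.flat_incl)
next
  case (unit X)
  then obtain g where g: "inverse_pair (base D) (ob X) (fl X) (iso X) g" by blast
  then have "ob X \<in> obj (base D)" using D.dom.hom_obj by (auto simp: inverse_pair_def)
  from D.prj_unit_inverse_pair[OF this] g show ?case
    using unit(1) D.dom.inverse_pair_cmp
    by (fastforce simp: interp_None C.free_ext_None unit_step_def Let_def)
next
  case (ty X A)
  then obtain g where g: "inverse_pair (base D) (ob X) (fl X) (iso X) g" by blast
  show ?case
    using D.ext_map_inverse_pair[OF F.on_ty_in[OF ty(2)] g] ty(1,2)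
    by (simp add: interp_Some C.free_ext_Some ty_step_def F.on_ext)
qed

lemma inverse_pair_iso:
  "X \<in> obj (free_cat C) \<Longrightarrow> inverse_pair (base D) (ob X) (fl X) (iso X) (inv_iso X)"
  using interp_iso[of X] D.dom.inverse_of_eq by blast

lemma iso_hom: "X \<in> obj (free_cat C) \<Longrightarrow> iso X \<in> hom (base D) (ob X) (fl X)"
  and inv_iso_hom: "X \<in> obj (free_cat C) \<Longrightarrow> inv_iso X \<in> hom (base D) (fl X) (ob X)"
  using inverse_pair_iso[of X] by (simp_all add: inverse_pair_def)

lemma ob_obj: "X \<in> obj (free_cat C) \<Longrightarrow> ob X \<in> obj (base D)"
  using D.dom.hom_obj iso_hom by blast

section \<open>Action on morphisms, types and terms\<close>

definition hom_lift :: "('o, 'u) unit_ctx set \<Rightarrow> ('o, 'u) unit_ctx set \<Rightarrow> 'm \<Rightarrow> 'm2" where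
  "hom_lift X Y f = cmp (base D) (ob X) (fl Y) (ob Y) (inv_iso Y)
     (cmp (base D) (ob X) (fl X) (fl Y) (on_hom F (flat C X) (flat C Y) f) (iso X))"

lemma hom_free_cat:
  "f \<in> hom (free_cat C) X Y \<longleftrightarrow>
    X \<in> obj (free_cat C) \<and> Y \<in> obj (free_cat C) \<and> f \<in> hom (base C) (flat C X) (flat C Y)"
  by (auto simp: free_cat_simps)

lemma
  assumes f: "f \<in> hom (free_cat C) X Y"
  shows hom_lift_hom: "hom_lift X Y f \<in> hom (base D) (ob X) (ob Y)"
    and iso_hom_lift: "cmp (base D) (ob X) (ob Y) (fl Y) (iso Y) (hom_lift X Y f) =
      cmp (base D) (ob X) (fl X) (fl Y) (on_hom F (flat C X) (flat C Y) f) (iso X)"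
proof -
  have X: "X \<in> obj (free_cat C)" and Y: "Y \<in> obj (free_cat C)"
    and f: "f \<in> hom (base C) (flat C X) (flat C Y)" using f by (auto simp: hom_free_cat)
  let ?g = "cmp (base D) (ob X) (fl X) (fl Y) (on_hom F (flat C X) (flat C Y) f) (iso X)"
  have g: "?g \<in> hom (base D) (ob X) (fl Y)"
    using iso_hom[OF X] F.on_hom_in[OF f] by (rule D.dom.cmp_hom)
  show "hom_lift X Y f \<in> hom (base D) (ob X) (ob Y)"
    unfolding hom_lift_def using g inv_iso_hom[OF Y] by (rule D.dom.cmp_hom)
  show "cmp (base D) (ob X) (ob Y) (fl Y) (iso Y) (hom_lift X Y f) = ?g"
    using D.dom.cmp_assoc[OF g inv_iso_hom[OF Y] iso_hom[OF Y]] inverse_pair_iso[OF Y]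
      D.dom.cmp_idn_left[OF g]
    by (simp add: hom_lift_def inverse_pair_def)
qed

text \<open>The isomorphism at Y can be cancelled. With this characterisation by a commuting square,
  \<open>inv_iso\<close> disappears from all later arguments.\<close>

lemma hom_lift_eqI:
  assumes f: "f \<in> hom (free_cat C) X Y" and h: "h \<in> hom (base D) (ob X) (ob Y)"
    and eq: "cmp (base D) (ob X) (ob Y) (fl Y) (iso Y) h =
      cmp (base D) (ob X) (fl X) (fl Y) (on_hom F (flat C X) (flat C Y) f) (iso X)"
  shows "h = hom_lift X Y f"
proof -
  have Y: "Y \<in> obj (free_cat C)" using f by (simp add: hom_free_cat)
  have "h = cmp (base D) (ob X) (fl Y) (ob Y) (inv_iso Y)
      (cmp (base D) (ob X) (ob Y) (fl Y) (iso Y) h)"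
    using D.dom.cmp_assoc[OF h iso_hom[OF Y] inv_iso_hom[OF Y]] inverse_pair_iso[OF Y]
      D.dom.cmp_idn_left[OF h] by (simp add: inverse_pair_def)
  then show ?thesis by (simp add: eq hom_lift_def)
qed

lemma hom_lift_idn:
  assumes X: "X \<in> obj (free_cat C)"
  shows "hom_lift X X (idn (base C) (flat C X)) = idn (base D) (ob X)"
  using X C.flat_obj[OF X] ob_obj[OF X] iso_hom[OF X]
  by (intro hom_lift_eqI[symmetric])
    (simp_all add: hom_free_cat C.dom.idn_hom D.dom.idn_hom F.on_idn D.dom.cmp_idn_left
      D.dom.cmp_idn_right)

text \<open>The squares for f and g paste to the square that characterises the lift of the
  composite.\<close>

lemma hom_lift_cmp:
  assumes f: "f \<in> hom (free_cat C) X Y" and g: "g \<in> hom (free_cat C) Y Z"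
  shows "hom_lift X Z (cmp (base C) (flat C X) (flat C Y) (flat C Z) g f) =
    cmp (base D) (ob X) (ob Y) (ob Z) (hom_lift Y Z g) (hom_lift X Y f)"
proof (rule hom_lift_eqI[symmetric])
  have X: "X \<in> obj (free_cat C)" and Y: "Y \<in> obj (free_cat C)" and Z: "Z \<in> obj (free_cat C)"
    and f': "f \<in> hom (base C) (flat C X) (flat C Y)"
    and g': "g \<in> hom (base C) (flat C Y) (flat C Z)" using f g by (auto simp: hom_free_cat)
  show "cmp (base C) (flat C X) (flat C Y) (flat C Z) g f \<in> hom (free_cat C) X Z"
    using X Z f' g' by (auto simp: hom_free_cat intro: C.dom.cmp_hom)
  show "cmp (base D) (ob X) (ob Y) (ob Z) (hom_lift Y Z g) (hom_lift X Y f)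
      \<in> hom (base D) (ob X) (ob Z)"
    using hom_lift_hom[OF f] hom_lift_hom[OF g] by (rule D.dom.cmp_hom)
  have "cmp (base D) (ob X) (ob Z) (fl Z) (iso Z)
        (cmp (base D) (ob X) (ob Y) (ob Z) (hom_lift Y Z g) (hom_lift X Y f)) =
      cmp (base D) (ob X) (ob Y) (fl Z)
        (cmp (base D) (ob Y) (ob Z) (fl Z) (iso Z) (hom_lift Y Z g)) (hom_lift X Y f)"
    by (rule D.dom.cmp_assoc[symmetric, OF hom_lift_hom[OF f] hom_lift_hom[OF g] iso_hom[OF Z]])
  also have "\<dots> = cmp (base D) (ob X) (fl Y) (fl Z) (on_hom F (flat C Y) (flat C Z) g)
        (cmp (base D) (ob X) (ob Y) (fl Y) (iso Y) (hom_lift X Y f))"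
    unfolding iso_hom_lift[OF g]
    by (rule D.dom.cmp_assoc[OF hom_lift_hom[OF f] iso_hom[OF Y] F.on_hom_in[OF g']])
  also have "\<dots> = cmp (base D) (ob X) (fl X) (fl Z)
        (on_hom F (flat C X) (flat C Z) (cmp (base C) (flat C X) (flat C Y) (flat C Z) g f)) (iso X)"
    unfolding iso_hom_lift[OF f] F.on_cmp[OF f' g']
    by (rule D.dom.cmp_assoc[symmetric, OF iso_hom[OF X] F.on_hom_in[OF f'] F.on_hom_in[OF g']])
  finally show "cmp (base D) (ob X) (ob Z) (fl Z) (iso Z)
        (cmp (base D) (ob X) (ob Y) (ob Z) (hom_lift Y Z g) (hom_lift X Y f)) = \<dots>" .
qed

definition ty_lift :: "('o, 'u) unit_ctx set \<Rightarrow> 'u option \<Rightarrow> 'v" where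
  "ty_lift X A = (case A of None \<Rightarrow> unit_ty_at D (ob X)
     | Some B \<Rightarrow> act (Ty D) (ob X) (fl X) (iso X) (on_ty F (flat C X) B))"

definition tm_lift :: "('o, 'u) unit_ctx set \<Rightarrow> 'e option \<Rightarrow> 'f" where
  "tm_lift X a = (case a of None \<Rightarrow> unit_tm_at D (ob X)
     | Some b \<Rightarrow> act (Tm D) (ob X) (fl X) (iso X) (on_tm F (flat C X) b))"

lemma ob_None: "X \<in> obj (free_cat C) \<Longrightarrow>
    ob (ext (free_unit_model C) X None) = ext D (ob X) (unit_ty_at D (ob X))"
  and iso_None: "X \<in> obj (free_cat C) \<Longrightarrow>
    iso (ext (free_unit_model C) X None) =
      cmp (base D) (ext D (ob X) (unit_ty_at D (ob X))) (ob X) (fl X) (iso X)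
        (prj D (ob X) (unit_ty_at D (ob X)))"
  by (simp_all add: interp_None unit_step_def Let_def)

lemma ob_Some: "X \<in> obj (free_cat C) \<Longrightarrow> A \<in> elts (Ty C) (flat C X) \<Longrightarrow>
    ob (ext (free_unit_model C) X (Some A)) = ext D (ob X) (ty_lift X (Some A))"
  and iso_Some: "X \<in> obj (free_cat C) \<Longrightarrow> A \<in> elts (Ty C) (flat C X) \<Longrightarrow>
    iso (ext (free_unit_model C) X (Some A)) =
      ext_map D (ob X) (fl X) (on_ty F (flat C X) A) (iso X)"
  by (simp_all add: interp_Some ty_step_def ty_lift_def)

lemma ty_lift_in:
  "A \<in> elts (free_psh C (Ty C)) X \<Longrightarrow> ty_lift X A \<in> elts (Ty D) (ob X)"
  by (auto simp: ty_lift_def free_psh_simps D.unit_ty_at_elts ob_obj split: if_splits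
      intro!: D.cod.act_elts[OF iso_hom] F.on_ty_in)

lemma tm_lift_in:
  "a \<in> elts (free_psh C (Tm C)) X \<Longrightarrow> tm_lift X a \<in> elts (Tm D) (ob X)"
  by (auto simp: tm_lift_def free_psh_simps D.unit_tm_at_elts ob_obj split: if_splits
      intro!: D.dom.act_elts[OF iso_hom] F.on_tm_in)

text \<open>For \<open>Some B\<close> both sides restrict the image of B under F, along the two
  sides of the square \<open>iso_hom_lift\<close>. For the bullet it is stability of the unit
  type.\<close>

lemma ty_lift_natural:
  assumes f: "f \<in> hom (free_cat C) Y X" and A: "A \<in> elts (free_psh C (Ty C)) X"
  shows "ty_lift Y (act (free_psh C (Ty C)) Y X f A) =
    act (Ty D) (ob Y) (ob X) (hom_lift Y X f) (ty_lift X A)"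
proof (cases A)
  case None
  then show ?thesis
    using hom_lift_hom[OF f] by (simp add: ty_lift_def free_psh_simps D.act_unit_ty_at)
next
  case (Some B)
  have X: "X \<in> obj (free_cat C)" and Y: "Y \<in> obj (free_cat C)"
    and f': "f \<in> hom (base C) (flat C Y) (flat C X)" using f by (auto simp: hom_free_cat)
  have B: "B \<in> elts (Ty C) (flat C X)" using A X Some by (auto simp: free_psh_simps)
  show ?thesis
    using D.cod.act_cmp[OF hom_lift_hom[OF f] iso_hom[OF X] F.on_ty_in[OF B]]
      D.cod.act_cmp[OF iso_hom[OF Y] F.on_hom_in[OF f'] F.on_ty_in[OF B]]
    by (simp add: Some ty_lift_def free_psh_simps F.on_ty_natural[OF f' B] iso_hom_lift[OF f])
qed

lemma tm_lift_natural:
  assumes f: "f \<in> hom (free_cat C) Y X" and a: "a \<in> elts (free_psh C (Tm C)) X"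
  shows "tm_lift Y (act (free_psh C (Tm C)) Y X f a) =
    act (Tm D) (ob Y) (ob X) (hom_lift Y X f) (tm_lift X a)"
proof (cases a)
  case None
  then show ?thesis
    using hom_lift_hom[OF f] by (simp add: tm_lift_def free_psh_simps D.act_unit_tm_at)
next
  case (Some b)
  have X: "X \<in> obj (free_cat C)" and Y: "Y \<in> obj (free_cat C)"
    and f': "f \<in> hom (base C) (flat C Y) (flat C X)" using f by (auto simp: hom_free_cat)
  have b: "b \<in> elts (Tm C) (flat C X)" using a X Some by (auto simp: free_psh_simps)
  show ?thesis
    using D.dom.act_cmp[OF hom_lift_hom[OF f] iso_hom[OF X] F.on_tm_in[OF b]]
      D.dom.act_cmp[OF iso_hom[OF Y] F.on_hom_in[OF f'] F.on_tm_in[OF b]]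
    by (simp add: Some tm_lift_def free_psh_simps F.on_tm_natural[OF f' b] iso_hom_lift[OF f])
qed

lemma ty_of_tm_lift:
  assumes a: "a \<in> elts (free_psh C (Tm C)) X"
  shows "ty_of D (ob X) (tm_lift X a) = ty_lift X (map_option (ty_of C (flat C X)) a)"
proof -
  have X: "X \<in> obj (free_cat C)" using a by (simp add: free_psh_simps split: if_splits)
  then show ?thesis
    using a by (auto simp: free_psh_simps tm_lift_def ty_lift_def ob_obj D.ty_of_unit_tm_at
        D.natural[OF iso_hom[OF X]] F.on_tm_in F.on_ty_of)
qed

section \<open>The extension of F\<close>

definition free_lift ::
    "(('o, 'u) unit_ctx set, 'm, 'u option, 'e option, 'o2, 'm2, 'v, 'f) map_data" where
  "free_lift =
    \<lparr>on_obj = (\<lambda>X\<in>obj (free_cat C). ob X),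
     on_hom = (\<lambda>X Y. \<lambda>f\<in>hom (free_cat C) X Y. hom_lift X Y f),
     on_ty = (\<lambda>X. \<lambda>A\<in>elts (free_psh C (Ty C)) X. ty_lift X A),
     on_tm = (\<lambda>X. \<lambda>a\<in>elts (free_psh C (Tm C)) X. tm_lift X a)\<rparr>"

lemma free_lift_simps:
  "X \<in> obj (free_cat C) \<Longrightarrow> on_obj free_lift X = ob X"
  "f \<in> hom (free_cat C) X Y \<Longrightarrow> on_hom free_lift X Y f = hom_lift X Y f"
  "A \<in> elts (free_psh C (Ty C)) X \<Longrightarrow> on_ty free_lift X A = ty_lift X A"
  "a \<in> elts (free_psh C (Tm C)) X \<Longrightarrow> on_tm free_lift X a = tm_lift X a"
  by (simp_all add: free_lift_def)

text \<open>The recursion was set up for this. For the bullet the projection is an identity, and the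
  required square is the definition of the new isomorphism; the variable is settled by the eta rule.
  For a type of the given model, the two equations that define the lift \<open>ext_map\<close> are
  those for projection and variable.\<close>

lemma hom_lift_prj:
  assumes A: "A \<in> elts (free_psh C (Ty C)) X"
  shows "ob (ext (free_unit_model C) X A) = ext D (ob X) (ty_lift X A)"
    and "hom_lift (ext (free_unit_model C) X A) X (prj (free_unit_model C) X A) =
      prj D (ob X) (ty_lift X A)"
    and "tm_lift (ext (free_unit_model C) X A) (var (free_unit_model C) X A) =
      var D (ob X) (ty_lift X A)"
proof -
  interpret N: unit_natural_model "free_unit_model C" by (rule C.free_unit_natural_model)
  have X: "X \<in> obj (free_cat C)" using A by (simp add: free_psh_simps split: if_splits)
  let ?E = "ext (free_unit_model C) X A" and ?p = "prj (free_unit_model C) X A"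
  let ?q = "prj D (ob X) (ty_lift X A)"
  have E: "?E \<in> obj (free_cat C)" and p: "?p \<in> hom (free_cat C) ?E X"
    using N.ext_obj N.prj_hom A by auto
  show ob: "ob ?E = ext D (ob X) (ty_lift X A)"
    using A X by (auto simp: free_psh_simps ob_None ob_Some) (simp add: ty_lift_def)
  have q: "?q \<in> hom (base D) (ob ?E) (ob X)"
    unfolding ob by (rule D.prj_hom[OF ty_lift_in[OF A]])
  have "cmp (base D) (ob ?E) (ob X) (fl X) (iso X) ?q =
      cmp (base D) (ob ?E) (fl ?E) (fl X) (on_hom F (flat C ?E) (flat C X) ?p) (iso ?E)"
  proof (cases A)
    case None
    show ?thesis
      using iso_hom[OF E] X C.flat_obj[OF X] unfolding None
      by (simp add: C.free_ext_None F.on_idn D.dom.cmp_idn_left)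
        (simp add: ob_None iso_None ty_lift_def)
  next
    case (Some B)
    have B: "B \<in> elts (Ty C) (flat C X)" using A X Some by (auto simp: free_psh_simps)
    show ?thesis
      using D.ext_map(2)[OF F.on_ty_in[OF B] iso_hom[OF X]] unfolding Some
      by (simp add: C.free_ext_Some[OF X B] F.on_prj[OF B] F.on_ext[OF B] iso_Some[OF X B]
          ob_Some[OF X B] ty_lift_def)
  qed
  then show "hom_lift ?E X ?p = ?q" using p q by (intro hom_lift_eqI[symmetric])
  show "tm_lift ?E (var (free_unit_model C) X A) = var D (ob X) (ty_lift X A)"
  proof (cases A)
    case None
    then show ?thesis
      using D.var_unit_ty_at[OF ob_obj[OF X]] X by (simp add: tm_lift_def ty_lift_def ob_None)
  next
    case (Some B)
    have B: "B \<in> elts (Ty C) (flat C X)" using A X Some by (auto simp: free_psh_simps)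
    show ?thesis
      using D.ext_map(3)[OF F.on_ty_in[OF B] iso_hom[OF X]] unfolding Some
      by (simp add: C.free_ext_Some[OF X B] F.on_var[OF B] F.on_ext[OF B] iso_Some[OF X B]
          ob_Some[OF X B] ty_lift_def tm_lift_def)
  qed
qed

lemma free_lift_morphism: "unit_model_morphism (free_unit_model C) D free_lift"
proof -
  interpret N: unit_natural_model "free_unit_model C" by (rule C.free_unit_natural_model)
  \<comment> \<open>Closure facts of the free model in unfolded form; they discharge the domain
    conditions of \<open>free_lift_simps\<close>.\<close>
  note obj = N.dom.hom_obj[unfolded free_unit_model_simps(1)]
  note idn = N.dom.idn_hom[unfolded free_unit_model_simps(1)]
  note cmp = N.dom.cmp_hom[unfolded free_unit_model_simps(1)]
  note ty_obj = N.cod.elts_obj[unfolded free_unit_model_simps(1,3)]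
  note tm_obj = N.dom.elts_obj[unfolded free_unit_model_simps(1,4)]
  note ty_act = N.cod.act_elts[unfolded free_unit_model_simps(1,3)]
  note tm_act = N.dom.act_elts[unfolded free_unit_model_simps(1,4)]
  note ty_of = N.component[unfolded free_unit_model_simps(3,4,5)]
  note ext = N.ext_obj[unfolded free_unit_model_simps(1,3)]
  note prj = N.prj_hom[unfolded free_unit_model_simps(1,3)]
  note var = N.var_elts[unfolded free_unit_model_simps(3,4)]
  note trm = C.incl_obj[OF C.trm_obj]
  have ob_trm: "ob (ctx_class C (trm C, 0, [])) = trm D"
    by (simp add: interp_incl C.trm_obj F.on_trm)
  show ?thesis
  proof (intro unit_model_morphism.intro model_morphism.intro model_morphism_axioms.intro
      unit_model_morphism_axioms.intro, unfold free_unit_model_simps(1-5,9,10))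
    show "on_obj free_lift \<in> obj (free_cat C) \<rightarrow>\<^sub>E obj (base D)"
      by (simp add: free_lift_def ob_obj)
    show "on_hom free_lift X Y \<in> hom (free_cat C) X Y \<rightarrow>\<^sub>E
        hom (base D) (on_obj free_lift X) (on_obj free_lift Y)" for X Y
      using obj[of _ X Y] by (auto simp: free_lift_def hom_lift_hom)
    show "on_ty free_lift \<Gamma> \<in> elts (free_psh C (Ty C)) \<Gamma> \<rightarrow>\<^sub>E
        elts (Ty D) (on_obj free_lift \<Gamma>)" for \<Gamma>
      using ty_obj[of _ \<Gamma>] by (auto simp: free_lift_def ty_lift_in)
    show "on_tm free_lift \<Gamma> \<in> elts (free_psh C (Tm C)) \<Gamma> \<rightarrow>\<^sub>E
        elts (Tm D) (on_obj free_lift \<Gamma>)" for \<Gamma>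
      using tm_obj[of _ \<Gamma>] by (auto simp: free_lift_def tm_lift_in)
    show "on_hom free_lift X X (idn (free_cat C) X) = idn (base D) (on_obj free_lift X)"
      if "X \<in> obj (free_cat C)" for X
      using that hom_lift_idn[OF that] idn[OF that]
      by (simp add: free_lift_simps free_cat_simps(2))
    show "on_hom free_lift X Z (cmp (free_cat C) X Y Z g f) =
        cmp (base D) (on_obj free_lift X) (on_obj free_lift Y) (on_obj free_lift Z)
          (on_hom free_lift Y Z g) (on_hom free_lift X Y f)"
      if "f \<in> hom (free_cat C) X Y" "g \<in> hom (free_cat C) Y Z" for f X Y g Z
      using that hom_lift_cmp[OF that] cmp[OF that] obj[OF that(1)] obj[OF that(2)]
      by (simp add: free_lift_simps free_cat_simps(3))
    show "on_obj free_lift (ctx_class C (trm C, 0, [])) = trm D"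
      using trm by (simp add: free_lift_simps ob_trm)
    show "on_ty free_lift \<Delta> (act (free_psh C (Ty C)) \<Delta> \<Gamma> \<sigma> A) =
        act (Ty D) (on_obj free_lift \<Delta>) (on_obj free_lift \<Gamma>) (on_hom free_lift \<Delta> \<Gamma> \<sigma>)
          (on_ty free_lift \<Gamma> A)"
      if "\<sigma> \<in> hom (free_cat C) \<Delta> \<Gamma>" "A \<in> elts (free_psh C (Ty C)) \<Gamma>" for \<sigma> \<Delta> \<Gamma> A
      using that ty_act[OF that] obj[OF that(1)] ty_lift_natural[OF that]
      by (simp add: free_lift_simps)
    show "on_tm free_lift \<Delta> (act (free_psh C (Tm C)) \<Delta> \<Gamma> \<sigma> a) =
        act (Tm D) (on_obj free_lift \<Delta>) (on_obj free_lift \<Gamma>) (on_hom free_lift \<Delta> \<Gamma> \<sigma>)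
          (on_tm free_lift \<Gamma> a)"
      if "\<sigma> \<in> hom (free_cat C) \<Delta> \<Gamma>" "a \<in> elts (free_psh C (Tm C)) \<Gamma>" for \<sigma> \<Delta> \<Gamma> a
      using that tm_act[OF that] obj[OF that(1)] tm_lift_natural[OF that]
      by (simp add: free_lift_simps)
    show "ty_of D (on_obj free_lift \<Gamma>) (on_tm free_lift \<Gamma> a) =
        on_ty free_lift \<Gamma> (map_option (ty_of C (flat C \<Gamma>)) a)"
      if "a \<in> elts (free_psh C (Tm C)) \<Gamma>" for a \<Gamma>
      using that tm_obj[OF that] ty_of[OF that] ty_of_tm_lift[OF that]
      by (simp add: free_lift_simps)
    fix A \<Gamma> assume A: "A \<in> elts (free_psh C (Ty C)) \<Gamma>"
    note l = hom_lift_prj[OF A] ty_obj[OF A] ext[OF A] prj[OF A] var[OF A]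
    show "on_obj free_lift (ext (free_unit_model C) \<Gamma> A) =
        ext D (on_obj free_lift \<Gamma>) (on_ty free_lift \<Gamma> A)"
      using A l by (simp add: free_lift_simps)
    show "on_hom free_lift (ext (free_unit_model C) \<Gamma> A) \<Gamma> (prj (free_unit_model C) \<Gamma> A) =
        prj D (on_obj free_lift \<Gamma>) (on_ty free_lift \<Gamma> A)"
      using A l by (simp add: free_lift_simps)
    show "on_tm free_lift (ext (free_unit_model C) \<Gamma> A) (var (free_unit_model C) \<Gamma> A) =
        var D (on_obj free_lift \<Gamma>) (on_ty free_lift \<Gamma> A)"
      using A l by (simp add: free_lift_simps del: free_unit_model_simps)
  next
    show "on_ty free_lift (ctx_class C (trm C, 0, [])) None = unit_ty D"
      using trm by (simp add: free_lift_simps free_psh_simps ty_lift_def ob_trm D.unit_ty_at_trm)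
    show "on_tm free_lift (ctx_class C (trm C, 0, [])) None = unit_tm D"
      using trm by (simp add: free_lift_simps free_psh_simps tm_lift_def ob_trm D.unit_tm_at_trm)
  qed (rule N.natural_model_axioms D.natural_model_axioms N.unit_natural_model_axioms
      D.unit_natural_model_axioms)+
qed

text \<open>On an included object the isomorphism is an identity, so conjugating by it or
  restricting along it changes nothing. Off the domains both sides are
  \<open>undefined\<close>.\<close>

lemma compose_free_lift: "compose_map C free_lift (free_incl C) = F"
proof (rule map_data.equality)
  note simps = compose_map_def free_incl_def free_lift_simps
  have h: "f \<in> hom (free_cat C) (ctx_class C (X, 0, [])) (ctx_class C (Y, 0, []))"
    if "f \<in> hom (base C) X Y" for f X Y
    using that C.dom.hom_obj[OF that] by (simp add: hom_free_cat C.incl_obj C.flat_incl)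
  show "on_obj (compose_map C free_lift (free_incl C)) = on_obj F"
    by (rule ext) (use PiE_arb[OF F.on_obj] in \<open>auto simp: simps C.incl_obj interp_incl\<close>)
  show "on_hom (compose_map C free_lift (free_incl C)) = on_hom F"
  proof (intro ext)
    fix X Y f
    show "on_hom (compose_map C free_lift (free_incl C)) X Y f = on_hom F X Y f"
    proof (cases "f \<in> hom (base C) X Y")
      case True
      note X = C.dom.hom_obj[OF True] and f = F.on_hom_in[OF True]
      have "hom_lift (ctx_class C (X, 0, [])) (ctx_class C (Y, 0, [])) f = on_hom F X Y f"
        using X f by (intro hom_lift_eqI[OF h[OF True], symmetric])
          (simp_all add: interp_incl C.flat_incl D.dom.cmp_idn_left D.dom.cmp_idn_right)
      then show ?thesis using True X h[OF True] by (simp add: simps)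
    qed (use PiE_arb[OF F.on_hom] in \<open>simp add: simps\<close>)
  qed
  show "on_ty (compose_map C free_lift (free_incl C)) = on_ty F"
  proof (intro ext)
    fix X A
    show "on_ty (compose_map C free_lift (free_incl C)) X A = on_ty F X A"
    proof (cases "A \<in> elts (Ty C) X")
      case True
      then show ?thesis
        using C.cod.elts_obj[OF True] F.on_ty_in[OF True]
        by (simp add: simps free_psh_simps C.incl_obj C.flat_incl interp_incl ty_lift_def
            D.cod.act_idn)
    qed (use PiE_arb[OF F.on_ty] in \<open>simp add: simps\<close>)
  qed
  show "on_tm (compose_map C free_lift (free_incl C)) = on_tm F"
  proof (intro ext)
    fix X a
    show "on_tm (compose_map C free_lift (free_incl C)) X a = on_tm F X a"
    proof (cases "a \<in> elts (Tm C) X")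
      case True
      then show ?thesis
        using C.dom.elts_obj[OF True] F.on_tm_in[OF True]
        by (simp add: simps free_psh_simps C.incl_obj C.flat_incl interp_incl tm_lift_def
            D.dom.act_idn)
    qed (use PiE_arb[OF F.on_tm] in \<open>simp add: simps\<close>)
  qed
qed simp

section \<open>Uniqueness of the extension\<close>

context
  fixes G
  assumes G: "unit_model_morphism (free_unit_model C) D G"
    and compose: "compose_map C G (free_incl C) = F"
begin

interpretation G: unit_model_morphism "free_unit_model C" D G by (rule G)

abbreviation incl :: "'o \<Rightarrow> ('o, 'u) unit_ctx set" where
  "incl \<Gamma> \<equiv> ctx_class C (\<Gamma>, 0, [])"

lemmas G_hom_in = G.on_hom_in[unfolded free_unit_model_simps(1)]
lemmas G_cmp = G.on_cmp[unfolded free_unit_model_simps(1)]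
lemmas G_ty_natural = G.on_ty_natural[unfolded free_unit_model_simps(1,3)]
lemmas G_tm_natural = G.on_tm_natural[unfolded free_unit_model_simps(1,4)]
lemmas G_ext = G.on_ext[unfolded free_unit_model_simps(3)]
lemmas G_prj = G.on_prj[unfolded free_unit_model_simps(3)]
lemmas G_var = G.on_var[unfolded free_unit_model_simps(3)]

lemma G_incl:
  shows G_incl_obj: "X \<in> obj (base C) \<Longrightarrow> on_obj G (incl X) = on_obj F X"
    and G_incl_hom: "f \<in> hom (base C) X Y \<Longrightarrow> on_hom G (incl X) (incl Y) f = on_hom F X Y f"
    and G_incl_ty: "A \<in> elts (Ty C) X \<Longrightarrow> on_ty G (incl X) (Some A) = on_ty F X A"
    and G_incl_tm: "a \<in> elts (Tm C) X \<Longrightarrow> on_tm G (incl X) (Some a) = on_tm F X a"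
proof -
  show "on_obj G (incl X) = on_obj F X" if "X \<in> obj (base C)"
    using that by (simp add: compose[symmetric] compose_map_def free_incl_def)
  show "on_hom G (incl X) (incl Y) f = on_hom F X Y f" if "f \<in> hom (base C) X Y"
    using that C.dom.hom_obj[OF that]
    by (simp add: compose[symmetric] compose_map_def free_incl_def)
  show "on_ty G (incl X) (Some A) = on_ty F X A" if "A \<in> elts (Ty C) X"
    using that C.cod.elts_obj[OF that]
    by (simp add: compose[symmetric] compose_map_def free_incl_def)
  show "on_tm G (incl X) (Some a) = on_tm F X a" if "a \<in> elts (Tm C) X"
    using that C.dom.elts_obj[OF that]
    by (simp add: compose[symmetric] compose_map_def free_incl_def)
qed

text \<open>One identity of the given model lies in many hom-sets of the free category; the end
  points passed to \<open>on_hom\<close> select the map from X to the included object.\<close>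

abbreviation to_flat :: "('o, 'u) unit_ctx set \<Rightarrow> 'm2" where
  "to_flat X \<equiv> on_hom G X (incl (flat C X)) (idn (base C) (flat C X))"

lemma to_flat_dom:
  "X \<in> obj (free_cat C) \<Longrightarrow> idn (base C) (flat C X) \<in> hom (free_cat C) X (incl (flat C X))"
  by (simp add: hom_free_cat C.incl_obj C.flat_obj C.flat_incl C.dom.idn_hom)

lemma to_flat_hom:
  "X \<in> obj (free_cat C) \<Longrightarrow> to_flat X \<in> hom (base D) (on_obj G X) (fl X)"
  using G_hom_in[OF to_flat_dom] by (simp add: G_incl_obj C.flat_obj)

text \<open>A map into an included object factors through the inclusion of \<open>flat C Y\<close>;
  the second factor runs between included objects, where G agrees with F.\<close>

lemma G_hom_incl:
  assumes Y: "Y \<in> obj (free_cat C)" and f: "f \<in> hom (base C) (flat C Y) \<Gamma>"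
  shows "on_hom G Y (incl \<Gamma>) f =
    cmp (base D) (on_obj G Y) (fl Y) (on_obj F \<Gamma>) (on_hom F (flat C Y) \<Gamma> f) (to_flat Y)"
proof -
  have \<Gamma>: "\<Gamma> \<in> obj (base C)" using f C.dom.hom_obj by blast
  then have "f \<in> hom (free_cat C) (incl (flat C Y)) (incl \<Gamma>)"
    using f Y by (simp add: hom_free_cat C.incl_obj C.flat_incl C.flat_obj)
  from G_cmp[OF to_flat_dom[OF Y] this] show ?thesis
    using Y f \<Gamma>
    by (simp add: free_cat_simps C.flat_incl C.flat_obj C.dom.cmp_idn_right G_incl_obj G_incl_hom)
qed

text \<open>Apply G to the composite of f with the comparison map of X. The result is the square
  that characterises \<open>hom_lift\<close>, with \<open>to_flat\<close> in place of
  \<open>iso\<close>.\<close>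

lemma to_flat_G_hom:
  assumes f: "f \<in> hom (free_cat C) Y X"
  shows "cmp (base D) (on_obj G Y) (on_obj G X) (fl X) (to_flat X) (on_hom G Y X f) =
    cmp (base D) (on_obj G Y) (fl Y) (fl X) (on_hom F (flat C Y) (flat C X) f) (to_flat Y)"
proof -
  have X: "X \<in> obj (free_cat C)" and Y: "Y \<in> obj (free_cat C)"
    and f': "f \<in> hom (base C) (flat C Y) (flat C X)" using f by (auto simp: hom_free_cat)
  show ?thesis
    using G_cmp[OF f to_flat_dom[OF X]] X f'
    by (simp add: free_cat_simps C.flat_incl C.flat_obj C.dom.cmp_idn_left G_incl_obj
        G_hom_incl[OF Y f'])
qed

lemma G_ty_None: "X \<in> obj (free_cat C) \<Longrightarrow> on_ty G X None = unit_ty_at D (on_obj G X)"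
  and G_tm_None: "X \<in> obj (free_cat C) \<Longrightarrow> on_tm G X None = unit_tm_at D (on_obj G X)"
  using G.on_unit_ty_at[of X] G.on_unit_tm_at[of X] by simp_all

text \<open>A over X is the restriction, along an identity of the given model, of A over the
  included object; naturality of G turns this into restriction along
  \<open>to_flat X\<close>.\<close>

lemma G_ty_Some:
  assumes X: "X \<in> obj (free_cat C)" and A: "A \<in> elts (Ty C) (flat C X)"
  shows "on_ty G X (Some A) =
    act (Ty D) (on_obj G X) (fl X) (to_flat X) (on_ty F (flat C X) A)"
  using G_ty_natural[OF to_flat_dom[OF X], of "Some A"] X A
  by (simp add: free_psh_simps C.incl_obj C.flat_incl C.flat_obj G_incl_ty G_incl_obj
      C.cod.act_idn)

lemma G_tm_Some:
  assumes X: "X \<in> obj (free_cat C)" and a: "a \<in> elts (Tm C) (flat C X)"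
  shows "on_tm G X (Some a) =
    act (Tm D) (on_obj G X) (fl X) (to_flat X) (on_tm F (flat C X) a)"
  using G_tm_natural[OF to_flat_dom[OF X], of "Some a"] X a
  by (simp add: free_psh_simps C.incl_obj C.flat_incl C.flat_obj G_incl_tm G_incl_obj
      C.dom.act_idn)

text \<open>Both halves go through one induction: the object at a type extension depends on the
  comparison map before it, since G of the type is a restriction along that map.\<close>

lemma G_interp:
  assumes "X \<in> obj (free_cat C)"
  shows "on_obj G X = ob X \<and> to_flat X = iso X"
  using assms
proof (induction rule: C.free_obj_induct)
  case (incl \<Gamma>)
  then show ?case
    by (simp add: interp_incl C.flat_incl G_incl_obj G_incl_hom C.dom.idn_hom F.on_idn)
next
  case (unit X)
  let ?E = "ext (free_unit_model C) X None"
  have N: "None \<in> elts (free_psh C (Ty C)) X" using unit by (simp add: free_psh_simps)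
  have p: "idn (base C) (flat C X) \<in> hom (free_cat C) ?E X"
    using unit by (simp add: hom_free_cat C.free_ext_None C.dom.idn_hom C.flat_obj)
  have obj: "on_obj G ?E = ob ?E"
    using G_ext[OF N] unit by (simp add: G_ty_None ob_None)
  \<comment> \<open>The square at the projection has an identity on the F side, so it reads off the
    new comparison map as the old one composed with the projection of D.\<close>
  moreover have "to_flat ?E = iso ?E"
    using to_flat_G_hom[OF p] G_prj[OF N] to_flat_hom[of ?E] unit obj
    by (simp add: C.free_ext_None iso_None G_ty_None ob_None F.on_idn C.flat_obj D.dom.cmp_idn_left)
  ultimately show ?case by simp
next
  case (ty X A)
  let ?E = "ext (free_unit_model C) X (Some A)" and ?A = "on_ty F (flat C X) A"
  have X: "X \<in> obj (free_cat C)" and A: "A \<in> elts (Ty C) (flat C X)" by fact+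
  have S: "Some A \<in> elts (free_psh C (Ty C)) X" using X A by (simp add: free_psh_simps)
  have E: "?E \<in> obj (free_cat C)" and fl_E: "flat C ?E = ext C (flat C X) A"
    using C.free_ext_Some[OF X A] by auto
  have p: "prj C (flat C X) A \<in> hom (free_cat C) ?E X"
    using X A E by (simp add: hom_free_cat fl_E C.prj_hom)
  have G_A: "on_ty G X (Some A) = act (Ty D) (ob X) (fl X) (iso X) ?A"
    using G_ty_Some[OF X A] ty.IH by simp
  have obj: "on_obj G ?E = ext D (ob X) (act (Ty D) (ob X) (fl X) (iso X) ?A)"
    using G_ext[OF S] ty.IH by (simp add: G_A)
  \<comment> \<open>A map into an extension is known by its projection and variable. The first comes
    from the square at the projection, the second from naturality of G on the variable of A.\<close>
  have "to_flat ?E = ext_map D (ob X) (fl X) ?A (iso X)"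
  proof (rule D.ext_map_eqI[OF F.on_ty_in[OF A] iso_hom[OF X]], fold obj)
    show "to_flat ?E \<in> hom (base D) (on_obj G ?E) (ext D (fl X) ?A)"
      using to_flat_hom[OF E] by (simp add: fl_E F.on_ext[OF A])
    show "cmp (base D) (on_obj G ?E) (ext D (fl X) ?A) (fl X) (prj D (fl X) ?A) (to_flat ?E) =
        cmp (base D) (on_obj G ?E) (ob X) (fl X) (iso X)
          (prj D (ob X) (act (Ty D) (ob X) (fl X) (iso X) ?A))"
      using to_flat_G_hom[OF p] G_prj[OF S] ty.IH
      by (simp add: fl_E F.on_ext[OF A] F.on_prj[OF A] G_A)
    show "act (Tm D) (on_obj G ?E) (ext D (fl X) ?A) (to_flat ?E) (var D (fl X) ?A) =
        var D (ob X) (act (Ty D) (ob X) (fl X) (iso X) ?A)"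
      using G_tm_Some[OF E, unfolded fl_E, OF C.var_elts[OF A]] G_var[OF S] ty.IH
      by (simp add: fl_E F.on_ext[OF A] F.on_var[OF A] G_A)
  qed
  then show ?case using obj by (simp add: ob_Some[OF X A] iso_Some[OF X A] ty_lift_def)
qed

text \<open>Once objects and comparison maps agree, the squares fix the action on morphisms, and
  restriction along the comparison maps fixes the action on types and terms.\<close>

lemma free_lift_unique: "G = free_lift"
proof -
  interpret L: unit_model_morphism "free_unit_model C" D free_lift by (rule free_lift_morphism)
  show ?thesis
  proof (rule model_morphism_map_eqI[OF G.model_morphism_axioms L.model_morphism_axioms],
      unfold free_unit_model_simps)
    show "on_obj G X = on_obj free_lift X" if "X \<in> obj (free_cat C)" for X
      using that G_interp[OF that] by (simp add: free_lift_simps)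
    show "on_hom G X Y f = on_hom free_lift X Y f" if f: "f \<in> hom (free_cat C) X Y" for X Y f
    proof -
      have X: "X \<in> obj (free_cat C)" and Y: "Y \<in> obj (free_cat C)"
        using f by (auto simp: hom_free_cat)
      show ?thesis
        using G_hom_in[OF f] to_flat_G_hom[OF f] G_interp[OF X] G_interp[OF Y] f
        by (simp add: free_lift_simps hom_lift_eqI)
    qed
    show "on_ty G X A = on_ty free_lift X A" if "A \<in> elts (free_psh C (Ty C)) X" for X A
      using that G_interp[of X]
      by (auto simp: free_lift_simps)
        (auto simp: free_psh_simps ty_lift_def G_ty_None G_ty_Some split: if_splits)
    show "on_tm G X a = on_tm free_lift X a" if "a \<in> elts (free_psh C (Tm C)) X" for X a
      using that G_interp[of X]
      by (auto simp: free_lift_simps)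
        (auto simp: free_psh_simps tm_lift_def G_tm_None G_tm_Some split: if_splits)
  qed
qed

end

end

theorem theorem4p4p9:
  fixes C :: "('o, 'm, 'u, 'e) model_data"
    and D :: "('o2, 'm2, 'v, 'f) unit_model_data"
    and F :: "('o, 'm, 'u, 'e, 'o2, 'm2, 'v, 'f) map_data"
  assumes "natural_model C"
    and "unit_natural_model D"
    and "model_morphism C D F"
  shows "\<exists>!G. unit_model_morphism (free_unit_model C) D G \<and> compose_map C G (free_incl C) = F"
proof -
  interpret unit_extension C D F using assms by (simp add: unit_extension_def)
  show ?thesis
    using free_lift_morphism compose_free_lift free_lift_unique by blast
qed

end
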